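(* Let $1<p<+\infty$, and let $Y\in\mathbb E_1$ with $Y\neq0$. (i) If $\omega=0$, then $Y$ is stable in $L^p$ norm of the absolute vorticity: for any $\varepsilon>0$ there exists $\delta>0$ such that for any smooth solution $\zeta$ of the vorticity equation $(V_0)$, $\|\zeta_0-Y\|_{L^p(\mathbb S^2)}<\delta$ implies $\|\zeta_t-Y\|_{L^p(\mathbb S^2)}<\varepsilon$ for all $t>0$. (ii) For general $\omega\in\mathbb R$, the set $\mathcal H^+_Y$ is stable in $L^p$ norm of the absolute vorticity: for any $\varepsilon>0$ there exists $\delta>0$ such that for any smooth solution $\zeta$ of the vorticity equation $(V_\omega)$, $$\min_{f\in\mathcal H^+_Y}\|f-\zeta_0\|_{L^p(\mathbb S^2)}<\delta\quad\Longrightarrow\quad \min_{f\in\mathcal H^+_Y}\|f-\zeta_t\|_{L^p(\mathbb S^2)}<\varepsilon\quad\forall\,t>0.$$ In particular, if $Y$ is zonal (i.e. $Y=\beta\sqrt{3/(4\pi)}\,\sin\theta$ for some $\beta\in\mathbb R$), then $Y$ itself is stable: for any $\varepsilon>0$ there exists $\delta>0$ such that for any smooth solution $\zeta$ of $(V_\omega)$, $\|\zeta_0-Y\|_{L^p(\mathbb S^2)}<\delta$ implies $\|\zeta_t-Y\|_{L^p(\mathbb S^2)}<\varepsilon$ for all $t>0$.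
   Context: $\mathbb S^2$ is the unit sphere in $\mathbb R^3$ with the standard metric and area measure $\sigma$, with spherical coordinates $(\varphi,\theta)\mapsto(\cos\theta\cos\varphi,\cos\theta\sin\varphi,\sin\theta)$; thus $\sin\theta=x_3$. All functions are real-valued. $\mathring L^p(\mathbb S^2)$ is the space of $L^p$ functions with zero mean. For $1<r<\infty$ and $f\in\mathring L^r(\mathbb S^2)$, $\mathcal Gf$ is the unique zero-mean function in $W^{2,r}(\mathbb S^2)$ with $-\Delta(\mathcal Gf)=f$ ($\Delta$ the Laplace-Beltrami operator). $J$ is the anticlockwise rotation by $\pi/2$ in the tangent planes, i.e. $J\mathbf v=\mathbf x\times\mathbf v$ at $\mathbf x\in\mathbb S^2$; in coordinates $J\nabla f=-\partial_\theta f\,\mathbf e_\varphi+\frac1{\cos\theta}\partial_\varphi f\,\mathbf e_\theta$. For a fixed rotation speed $\omega\in\mathbb R$, the vorticity equation $(V_\omega)$ for the absolute vorticity $\zeta$ is $$\partial_t\zeta+J\nabla(\omega\sin\theta-\mathcal G\zeta)\cdot\nabla\zeta=0\quad\text{on }\mathbb S^2,\ t>0.$$ A smooth solution is a smooth function $\zeta$ on $\mathbb S^2\times[0,\infty)$, of zero mean on $\mathbb S^2$ at each time, satisfying this equation; $\zeta_t:=\zeta(\cdot,t)$. $\mathbb E_1$ is the space of real functions $Y$ on $\mathbb S^2$ with $-\Delta Y=2Y$. For $f:\mathbb S^2\to\mathbb R$, $\mathcal H^+_f=\{f\circ\mathsf g\mid\mathsf g\in\mathbf H^+\}$, where $\mathbf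 H^+$ is the group of rotations about the $x_3$-axis; in coordinates $\mathcal H^+_f=\{f(\varphi+\beta,\theta)\mid\beta\in\mathbb R\}$. *)

theory Defs
  imports "HOL-Analysis.Analysis"
begin

section \<open>The unit sphere and its area measure\<close>

text \<open>Functions on the sphere are functions on \<open>real^3\<close>; every notion below
  depends only on their values on \<open>S2\<close>.\<close>

abbreviation S2 :: "(real^3) set" where
  "S2 \<equiv> sphere 0 1"

definition sph_coords :: "real \<times> real \<Rightarrow> real^3" where
  "sph_coords = (\<lambda>(\<phi>, \<theta>). vector [cos \<theta> * cos \<phi>, cos \<theta> * sin \<phi>, sin \<theta>])"

text \<open>The area element is \<open>cos \<theta> d\<phi> d\<theta>\<close>. The underlying space is \<open>S2\<close> itself, not
  \<open>real^3\<close>, so that measurability does not depend on values off the sphere.\<close>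

definition area :: "(real^3) measure" where
  "area = distr
     (density lborel
       (\<lambda>(\<phi>, \<theta>). indicator ({0..2 * pi} \<times> {- (pi / 2)..pi / 2}) (\<phi>, \<theta>) * ennreal (cos \<theta>)))
     (restrict_space borel S2) sph_coords"

definition Lp_mem :: "real \<Rightarrow> (real^3 \<Rightarrow> real) \<Rightarrow> bool" where
  "Lp_mem p f \<longleftrightarrow> f \<in> borel_measurable area \<and> integrable area (\<lambda>x. \<bar>f x\<bar> powr p)"

definition Lp_norm :: "real \<Rightarrow> (real^3 \<Rightarrow> real) \<Rightarrow> real" where
  "Lp_norm p f = (\<integral>x. \<bar>f x\<bar> powr p \<partial>area) powr (1 / p)"

definition zero_mean :: "(real^3 \<Rightarrow> real) \<Rightarrow> bool" where
  "zero_mean f \<longleftrightarrow> integrable area f \<and> (\<integral>x. f x \<partial>area) = 0"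


section \<open>Smooth functions\<close>

text \<open>\<open>Ck_on k f U\<close> is meant for open \<open>U\<close>.\<close>

primrec Ck_on :: "nat \<Rightarrow> ('a::euclidean_space \<Rightarrow> real) \<Rightarrow> 'a set \<Rightarrow> bool" where
  "Ck_on 0 f U \<longleftrightarrow> continuous_on U f"
| "Ck_on (Suc k) f U \<longleftrightarrow> (\<forall>x\<in>U. f differentiable (at x)) \<and>
     (\<forall>b\<in>Basis. Ck_on k (\<lambda>x. frechet_derivative f (at x) b) U)"

text \<open>Smoothness on a set that need not be open (the sphere, or the manifold with boundary
  \<open>[0,\<infinity>) \<times> S2\<close>) means existence of a smooth extension to an open neighbourhood.\<close>

definition smooth_on :: "('a::euclidean_space \<Rightarrow> real) \<Rightarrow> 'a set \<Rightarrow> bool" where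
  "smooth_on f S \<longleftrightarrow>
     (\<exists>U F. open U \<and> S \<subseteq> U \<and> (\<forall>k. Ck_on k F U) \<and> (\<forall>x\<in>S. F x = f x))"


section \<open>Differential operators on the sphere\<close>

text \<open>Functions and fields are extended radially, by composition with \<open>sgn x = x / norm x\<close>,
  before they are differentiated. At \<open>x\<close> on the sphere this extension has zero derivative in the
  normal direction, so its Euclidean gradient is the tangential gradient, and for a tangential
  field the trace of its Euclidean derivative is the intrinsic divergence.\<close>

definition sgrad :: "(real^3 \<Rightarrow> real) \<Rightarrow> real^3 \<Rightarrow> real^3" where
  "sgrad f x = (\<Sum>b\<in>Basis. frechet_derivative (\<lambda>y. f (sgn y)) (at x) b *\<^sub>R b)"

definition sdiv :: "(real^3 \<Rightarrow> real^3) \<Rightarrow> real^3 \<Rightarrow> real" where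
  "sdiv X x = (\<Sum>b\<in>Basis. frechet_derivative (\<lambda>y. X (sgn y)) (at x) b \<bullet> b)"

definition slaplace :: "(real^3 \<Rightarrow> real) \<Rightarrow> real^3 \<Rightarrow> real" where
  "slaplace f = sdiv (sgrad f)"

text \<open>Covariant Hessian: the Levi-Civita connection is the tangential part of the Euclidean
  derivative.\<close>

definition shess :: "(real^3 \<Rightarrow> real) \<Rightarrow> real^3 \<Rightarrow> real^3 \<Rightarrow> real^3" where
  "shess f x v =
     (let w = frechet_derivative (\<lambda>y. sgrad f (sgn y)) (at x) v in w - (w \<bullet> x) *\<^sub>R x)"

definition shess_norm :: "(real^3 \<Rightarrow> real) \<Rightarrow> real^3 \<Rightarrow> real" where
  "shess_norm f x = sqrt (\<Sum>b\<in>Basis. (norm (shess f x b))\<^sup>2)"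

definition Jrot :: "real^3 \<Rightarrow> real^3 \<Rightarrow> real^3" where
  "Jrot x v = cross3 x v"


section \<open>The Sobolev space of order two and the inverse Laplacian\<close>

definition W2_norm :: "real \<Rightarrow> (real^3 \<Rightarrow> real) \<Rightarrow> real" where
  "W2_norm r f = Lp_norm r f + Lp_norm r (\<lambda>x. norm (sgrad f x)) + Lp_norm r (shess_norm f)"

text \<open>\<open>W2_laplacian r u h\<close>: \<open>u\<close> belongs to \<open>W\<^sup>2\<^sup>,\<^sup>r\<close>, the completion of the smooth functions under
  \<open>W2_norm r\<close> realised inside \<open>L\<^sup>r\<close>, and \<open>\<Delta>u = h\<close>, where \<open>\<Delta>\<close> is the continuous extension to
  \<open>W\<^sup>2\<^sup>,\<^sup>r\<close> of the Laplacian of smooth functions.\<close>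

definition W2_laplacian :: "real \<Rightarrow> (real^3 \<Rightarrow> real) \<Rightarrow> (real^3 \<Rightarrow> real) \<Rightarrow> bool" where
  "W2_laplacian r u h \<longleftrightarrow> Lp_mem r u \<and> Lp_mem r h \<and>
     (\<exists>v :: nat \<Rightarrow> real^3 \<Rightarrow> real.
        (\<forall>n. smooth_on (v n) S2) \<and>
        (\<forall>e>0. \<exists>N. \<forall>m\<ge>N. \<forall>n\<ge>N. W2_norm r (\<lambda>x. v m x - v n x) < e) \<and>
        (\<lambda>n. Lp_norm r (\<lambda>x. v n x - u x)) \<longlonglongrightarrow> 0 \<and>
        (\<lambda>n. Lp_norm r (\<lambda>x. slaplace (v n) x - h x)) \<longlonglongrightarrow> 0)"

text \<open>\<open>is_G r f u\<close>: \<open>u\<close> is a representative of \<open>\<G>f\<close>, with \<open>f\<close> regarded as an element of \<open>L\<^sup>r\<close>.\<close>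

definition is_G :: "real \<Rightarrow> (real^3 \<Rightarrow> real) \<Rightarrow> (real^3 \<Rightarrow> real) \<Rightarrow> bool" where
  "is_G r f u \<longleftrightarrow> zero_mean u \<and> W2_laplacian r u (\<lambda>x. - f x)"


section \<open>The vorticity equation\<close>

text \<open>\<open>\<psi>\<close> is the smooth representative of \<open>\<G>\<zeta>\<^sub>t\<close>, which exists by elliptic regularity and is the
  same for all \<open>r\<close> because \<open>\<zeta>\<^sub>t\<close> is smooth.\<close>

definition smooth_solution :: "real \<Rightarrow> (real \<Rightarrow> real^3 \<Rightarrow> real) \<Rightarrow> bool" where
  "smooth_solution \<omega> \<zeta> \<longleftrightarrow>
     smooth_on (\<lambda>(t, x). \<zeta> t x) ({0..} \<times> S2) \<and>
     (\<forall>t\<ge>0. zero_mean (\<zeta> t)) \<and>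
     (\<forall>t>0. \<exists>\<psi>. smooth_on \<psi> S2 \<and> (\<forall>r>1. is_G r (\<zeta> t) \<psi>) \<and>
        (\<forall>x\<in>S2. deriv (\<lambda>s. \<zeta> s x) t
             + Jrot x (sgrad (\<lambda>y. \<omega> * y $ 3 - \<psi> y) x) \<bullet> sgrad (\<zeta> t) x = 0))"


section \<open>The first eigenspace and orbits under rotations about the third axis\<close>

definition E1 :: "(real^3 \<Rightarrow> real) set" where
  "E1 = {Y. smooth_on Y S2 \<and> (\<forall>x\<in>S2. - slaplace Y x = 2 * Y x)}"

definition rot3 :: "real \<Rightarrow> real^3 \<Rightarrow> real^3" where
  "rot3 \<beta> x = vector [cos \<beta> * x $ 1 - sin \<beta> * x $ 2, sin \<beta> * x $ 1 + cos \<beta> * x $ 2, x $ 3]"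

definition orbit :: "(real^3 \<Rightarrow> real) \<Rightarrow> (real^3 \<Rightarrow> real) set" where
  "orbit f = {f \<circ> g | g. g \<in> range rot3}"

text \<open>A genuine minimum: \<open>LEAST\<close> on the reals is meaningful only when it is attained, as it is
  for the orbit of a continuous function.\<close>

definition min_dist :: "real \<Rightarrow> (real^3 \<Rightarrow> real) set \<Rightarrow> (real^3 \<Rightarrow> real) \<Rightarrow> real" where
  "min_dist p H g = (LEAST d. \<exists>f\<in>H. d = Lp_norm p (\<lambda>x. f x - g x))"

end

theory Submission
  imports Defs
begin

text \<open>Every \<open>Y \<in> E1\<close> is the restriction of a linear function \<open>a \<bullet> x\<close>, and transport by a
  divergence-free field conserves the Casimirs \<open>\<integral> \<Phi>(\<zeta>)\<close>. Choose \<open>\<Phi>\<close> convex with \<open>\<Phi>(s) = s\<^sup>2 / 2\<close> for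
  \<open>\<bar>s\<bar> \<le> norm a\<close> and growth of order \<open>p\<close> at infinity. The Bregman divergence of \<open>\<zeta>\<close> from \<open>y = a \<bullet> x\<close> is then
  \<open>\<Phi>(\<zeta>) - y \<zeta> + y\<^sup>2 / 2\<close>: its integral involves \<open>\<zeta>\<close> only through a Casimir and a first moment. The
  first moments rotate about the third axis with angular speed \<open>\<omega>\<close>, because the generators of
  rotations are antisymmetric and commute with the Laplacian. Hence the integrated divergence of
  \<open>\<zeta>\<^sub>t\<close> from \<open>Y \<circ> rot3 (\<beta> + \<omega> t)\<close> is constant in time, and its smallness is equivalent to smallness of
  the \<open>L\<^sup>p\<close> distance.\<close>

section \<open>Calculus of \<open>Ck_on\<close>\<close>

text \<open>The exponent forces the shape of \<open>Phi\<close>. The quadratic Casimir controls only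
  the L2 distance: for p > 2 this does not bound the Lp distance, and for p < 2 it may be large
  under an Lp-small perturbation. The Bregman divergence, however, linearises the density only at
  values of the profile, so outside their range the density is free and can be given growth p.
  Inside the range it stays quadratic, and is comparable with the p-th power only up to an additive
  error; this error is harmless because the sphere has finite area. The moving profile itself solves
  the equation, so a single estimate, uniform in the speed, the initial angle and the time, yields
  the stability of the orbit as well as of profiles at rest, without any compactness of the
  perturbations. Spherical coordinates degenerate at the poles. They serve in only one integration
  by parts, for a single rotation generator; the Laplacian and the transport term are then written
  as sums over generators acting on radial extensions.\<close>

lemma Ck_on_cong:
  assumes "open U" "\<And>x. x \<in> U \<Longrightarrow> f x = g x" "Ck_on k f U"
  shows "Ck_on k g U"
  using assms(2,3)
proof (induction k arbitrary: f g)
  case 0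
  then show ?case by (metis Ck_on.simps(1) continuous_on_eq)
next
  case (Suc k)
  have "frechet_derivative f (at x) = frechet_derivative g (at x)" if "x \<in> U" for x
    using Suc.prems that \<open>open U\<close> by (intro frechet_derivative_transform_within_open[of f x U g]) auto
  moreover have "g differentiable (at x)" if "x \<in> U" for x
  proof -
    have "(f has_derivative frechet_derivative f (at x)) (at x)"
      using Suc.prems that frechet_derivative_works by auto
    then have "(g has_derivative frechet_derivative f (at x)) (at x)"
      using has_derivative_transform_within_open[OF _ \<open>open U\<close> that] Suc.prems(1) by blast
    then show ?thesis by (rule differentiableI)
  qed
  ultimately show ?case
    using Suc.prems(2) by (auto intro: Suc.IH[rotated])
qed

lemma Ck_on_SucD: "Ck_on (Suc k) f U \<Longrightarrow> Ck_on k f U"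
proof (induction k arbitrary: f)
  case 0
  then show ?case
    by (auto intro!: continuous_at_imp_continuous_on differentiable_imp_continuous_within)
qed auto

text \<open>Explicit formulas for derivatives enter through this rule, since the recursion itself
  speaks of \<open>frechet_derivative\<close>.\<close>

lemma Ck_on_SucI:
  assumes "open U" "\<And>x. x \<in> U \<Longrightarrow> (f has_derivative f' x) (at x)"
    and "\<And>b. b \<in> Basis \<Longrightarrow> Ck_on k (\<lambda>x. f' x b) U"
  shows "Ck_on (Suc k) f U"
proof -
  have "frechet_derivative f (at x) = f' x" if "x \<in> U" for x
    using assms(2)[OF that] frechet_derivative_at by metis
  then show ?thesis
    using assms(1,2,3) by (auto intro: differentiableI Ck_on_cong[OF assms(1), of "\<lambda>x. f' x b" for b])
qed

lemma Ck_on_has_derivative: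
  "Ck_on (Suc k) f U \<Longrightarrow> x \<in> U \<Longrightarrow> (f has_derivative frechet_derivative f (at x)) (at x)"
  using frechet_derivative_works by auto

lemma Ck_on_const: "open U \<Longrightarrow> Ck_on k (\<lambda>x. c) U"
  by (induction k arbitrary: c) auto

lemma Ck_on_linear:
  fixes l :: "'a::euclidean_space \<Rightarrow> real"
  assumes "open U" "bounded_linear l"
  shows "Ck_on k l U"
proof (cases k)
  case 0
  then show ?thesis using assms(2) by (simp add: linear_continuous_on)
next
  case (Suc n)
  show ?thesis
    unfolding Suc using assms
    by (intro Ck_on_SucI[of U l "\<lambda>_. l"] Ck_on_const) (auto intro: bounded_linear_imp_has_derivative)
qed

lemma Ck_on_add:
  assumes "open U" "Ck_on k f U" "Ck_on k g U"
  shows "Ck_on k (\<lambda>x. f x + g x) U"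
  using assms(2,3)
proof (induction k arbitrary: f g)
  case (Suc k)
  show ?case
    using Suc by (intro Ck_on_SucI[OF assms(1) has_derivative_add[OF Ck_on_has_derivative Ck_on_has_derivative]]) auto
qed (auto intro: continuous_intros)

lemma Ck_on_mult:
  assumes "open U" "Ck_on k f U" "Ck_on k g U"
  shows "Ck_on k (\<lambda>x. f x * g x) U"
  using assms(2,3)
proof (induction k arbitrary: f g)
  case (Suc k)
  show ?case
    using Suc by (intro Ck_on_SucI[OF assms(1) has_derivative_mult[OF Ck_on_has_derivative Ck_on_has_derivative]]
      Ck_on_add[OF assms(1)] Suc.IH Ck_on_SucD[OF Suc.prems(1)] Ck_on_SucD[OF Suc.prems(2)]) auto
qed (auto intro: continuous_intros)

lemma Ck_on_sum:
  assumes "open U" "\<And>i. i \<in> I \<Longrightarrow> Ck_on k (f i) U"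
  shows "Ck_on k (\<lambda>x. \<Sum>i\<in>I. f i x) U"
  using assms(2)
  by (induction I rule: infinite_finite_induct) (auto intro: Ck_on_const Ck_on_add assms(1))

text \<open>By the chain rule a partial derivative of the composite is a sum of products (partial
  derivative of \<open>F\<close>, composed with \<open>g\<close>) times (partial derivative of a
  component of \<open>g\<close>). The induction therefore keeps \<open>g\<close> fixed and varies
  \<open>F\<close>. Regularity of \<open>g\<close> is stated by components because
  \<open>Ck_on\<close> is real-valued.\<close>

lemma Ck_on_compose:
  fixes F :: "'b::euclidean_space \<Rightarrow> real" and g :: "'a::euclidean_space \<Rightarrow> 'b"
  assumes "open V" "g ` V \<subseteq> U" "Ck_on k F U" "\<And>c. c \<in> Basis \<Longrightarrow> Ck_on k (\<lambda>x. g x \<bullet> c) V"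
  shows "Ck_on k (\<lambda>x. F (g x)) V"
  using assms(3,4)
proof (induction k arbitrary: F)
  case 0
  have "continuous_on V g"
    using 0(2) continuous_on_componentwise[of V g] by simp
  then show ?case
    using 0(1) assms(2) by (auto intro: continuous_on_compose2)
next
  case (Suc k)
  let ?g' = "\<lambda>x. \<lambda>h. \<Sum>c\<in>Basis. frechet_derivative (\<lambda>x. g x \<bullet> c) (at x) h *\<^sub>R c"
  have g': "(g has_derivative ?g' x) (at x)" if "x \<in> V" for x
  proof (subst has_derivative_componentwise_within, safe)
    fix c :: 'b assume c: "c \<in> Basis"
    have "(\<lambda>h. ?g' x h \<bullet> c) = frechet_derivative (\<lambda>x. g x \<bullet> c) (at x)"
      using c by simp
    then show "((\<lambda>x. g x \<bullet> c) has_derivative (\<lambda>h. ?g' x h \<bullet> c)) (at x)"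
      using Ck_on_has_derivative[OF Suc.prems(2)[OF c] that] by (simp only:)
  qed
  have F': "((\<lambda>x. F (g x)) has_derivative (\<lambda>h. \<Sum>c\<in>Basis. frechet_derivative F (at (g x)) c *
      frechet_derivative (\<lambda>x. g x \<bullet> c) (at x) h)) (at x)" if "x \<in> V" for x
  proof -
    have d: "(F has_derivative frechet_derivative F (at (g x))) (at (g x))"
      using Ck_on_has_derivative[OF Suc.prems(1)] that assms(2) by auto
    have l: "linear (frechet_derivative F (at (g x)))"
      using d has_derivative_linear by blast
    have "(\<lambda>h. frechet_derivative F (at (g x)) (?g' x h)) =
      (\<lambda>h. \<Sum>c\<in>Basis. frechet_derivative F (at (g x)) c * frechet_derivative (\<lambda>x. g x \<bullet> c) (at x) h)"
      by (auto simp: linear_sum[OF l] linear_cmul[OF l] mult.commute)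
    then show ?thesis
      using has_derivative_compose[OF g'[OF that] d] by simp
  qed
  show ?case
  proof (rule Ck_on_SucI[OF assms(1) F'])
    fix b :: 'a assume b: "b \<in> Basis"
    show "Ck_on k (\<lambda>x. \<Sum>c\<in>Basis. frechet_derivative F (at (g x)) c *
        frechet_derivative (\<lambda>x. g x \<bullet> c) (at x) b) V"
    proof (rule Ck_on_sum[OF assms(1)], rule Ck_on_mult[OF assms(1)])
      fix c :: 'b assume c: "c \<in> Basis"
      have "Ck_on k (\<lambda>x. frechet_derivative F (at x) c) U"
        using Suc.prems(1) c by simp
      from Suc.IH[OF this] show "Ck_on k (\<lambda>x. frechet_derivative F (at (g x)) c) V"
        using Suc.prems(2) Ck_on_SucD by blast
      show "Ck_on k (\<lambda>x. frechet_derivative (\<lambda>x. g x \<bullet> c) (at x) b) V"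
        using Suc.prems(2)[OF c] b by simp
    qed
  qed
qed

section \<open>Smoothness of the radial projection away from the origin\<close>

lemma has_derivative_inverse_norm_power:
  fixes x :: "'a::euclidean_space"
  assumes "x \<noteq> 0"
  shows "((\<lambda>x. inverse (norm x) ^ m) has_derivative
    (\<lambda>h. - (real m * ((h \<bullet> x) * inverse (norm x) ^ (m + 2))))) (at x)"
proof (rule has_derivative_eq_rhs)
  show "((\<lambda>x. inverse (norm x) ^ m) has_derivative
    (\<lambda>h. real m * (- (inverse (norm x) * (h \<bullet> sgn x) * inverse (norm x))) * inverse (norm x) ^ (m - 1))) (at x)"
    using assms by (auto intro!: derivative_eq_intros has_derivative_norm[THEN has_derivative_eq_rhs] simp: inner_commute)
  \<comment> \<open>For m = 0 the truncated exponent \<open>m - 1\<close> is harmless, as the factor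
    \<open>real m\<close> vanishes.\<close>
  have "real m * (- (inverse (norm x) * (h \<bullet> sgn x) * inverse (norm x))) * inverse (norm x) ^ (m - 1)
     = - (real m * ((h \<bullet> x) * inverse (norm x) ^ (m + 2)))" for h
    by (cases m) (auto simp: sgn_div_norm field_simps power2_eq_square)
  then show "(\<lambda>h. real m * (- (inverse (norm x) * (h \<bullet> sgn x) * inverse (norm x))) * inverse (norm x) ^ (m - 1))
     = (\<lambda>h. - (real m * ((h \<bullet> x) * inverse (norm x) ^ (m + 2))))"
    by (rule ext)
qed

text \<open>All powers are treated at once because differentiation turns exponent m into a linear
  factor times exponent m + 2.\<close>

lemma Ck_on_inverse_norm_power:
  "Ck_on k (\<lambda>x::'a::euclidean_space. inverse (norm x) ^ m) (- {0})"
proof (induction k arbitrary: m)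
  case 0
  show ?case by (auto intro!: continuous_intros)
next
  case (Suc k)
  have "Ck_on k (\<lambda>x::'a. (- real m * (b \<bullet> x)) * inverse (norm x) ^ (m + 2)) (- {0})" for b
    by (intro Ck_on_mult Suc Ck_on_const Ck_on_linear) (auto intro!: bounded_linear_intros)
  then have "Ck_on k (\<lambda>x::'a. - (real m * ((b \<bullet> x) * inverse (norm x) ^ (m + 2)))) (- {0})" for b
    by (simp add: mult.assoc)
  then show ?case
    by (intro Ck_on_SucI[OF _ has_derivative_inverse_norm_power]) auto
qed

lemma Ck_on_sgn: "Ck_on k (\<lambda>x::'a::euclidean_space. sgn x \<bullet> c) (- {0})"
proof -
  have "Ck_on k (\<lambda>x::'a. (x \<bullet> c) * inverse (norm x) ^ 1) (- {0})"
    by (intro Ck_on_mult Ck_on_inverse_norm_power Ck_on_linear) (auto intro!: bounded_linear_intros)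
  then show ?thesis
    by (simp add: sgn_div_norm divide_inverse mult.commute)
qed

section \<open>Symmetry of second derivatives\<close>

lemma second_difference_MVT:
  fixes f :: "'a::euclidean_space \<Rightarrow> real"
  assumes "0 < s"
    and in_U: "\<And>u v. \<lbrakk>0 \<le> u; u \<le> s; 0 \<le> v; v \<le> s\<rbrakk> \<Longrightarrow> x + u *\<^sub>R a + v *\<^sub>R b \<in> U"
    and f: "\<And>y. y \<in> U \<Longrightarrow> f differentiable at y"
    and fa: "\<And>y. y \<in> U \<Longrightarrow> (\<lambda>y. frechet_derivative f (at y) a) differentiable at y"
  shows "\<exists>u v. 0 < u \<and> u < s \<and> 0 < v \<and> v < s \<and>
    f (x + s *\<^sub>R a + s *\<^sub>R b) - f (x + s *\<^sub>R a) - f (x + s *\<^sub>R b) + f x =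
    s\<^sup>2 * frechet_derivative (\<lambda>y. frechet_derivative f (at y) a) (at (x + u *\<^sub>R a + v *\<^sub>R b)) b"
proof -
  let ?fa = "\<lambda>y. frechet_derivative f (at y) a"
  have line: "((\<lambda>u. g (y + u *\<^sub>R c)) has_real_derivative frechet_derivative g (at (y + u *\<^sub>R c)) c) (at u)"
    if "g differentiable at (y + u *\<^sub>R c)" for g :: "'a \<Rightarrow> real" and y c u
  proof -
    have d: "(g has_derivative frechet_derivative g (at (y + u *\<^sub>R c))) (at (y + u *\<^sub>R c))"
      using that frechet_derivative_works by blast
    have "((\<lambda>u. y + u *\<^sub>R c) has_derivative (\<lambda>h. h *\<^sub>R c)) (at u)"
      by (auto intro!: derivative_eq_intros)
    from has_derivative_compose[OF this d] show ?thesis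
      using linear_cmul[OF has_derivative_linear[OF d]]
      by (simp add: has_field_derivative_def mult.commute[of _ "frechet_derivative g (at (y + u *\<^sub>R c)) c"])
  qed
  \<comment> \<open>The second difference is the increment of \<open>g\<close>, the difference of
    \<open>f\<close> along two parallel segments. The mean value theorem is applied to
    \<open>g\<close> along \<open>a\<close>, then to the partial derivative \<open>?fa\<close> along
    \<open>b\<close>.\<close>
  define g where "g u = f ((x + s *\<^sub>R b) + u *\<^sub>R a) - f (x + u *\<^sub>R a)" for u
  have "(g has_real_derivative ?fa ((x + s *\<^sub>R b) + u *\<^sub>R a) - ?fa (x + u *\<^sub>R a)) (at u)"
    if "0 \<le> u" "u \<le> s" for u
    unfolding g_def
    using that in_U[of u s] in_U[of u 0] \<open>0 < s\<close>
    by (intro DERIV_diff line f) (auto simp: algebra_simps)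
  then have "\<exists>u. 0 < u \<and> u < s \<and> g s - g 0 = (s - 0) * (?fa ((x + s *\<^sub>R b) + u *\<^sub>R a) - ?fa (x + u *\<^sub>R a))"
    using \<open>0 < s\<close> by (intro MVT2) auto
  then obtain u where u: "0 < u" "u < s" "g s - g 0 = s * (?fa ((x + s *\<^sub>R b) + u *\<^sub>R a) - ?fa (x + u *\<^sub>R a))"
    by auto
  have "((\<lambda>v. ?fa ((x + u *\<^sub>R a) + v *\<^sub>R b)) has_real_derivative
      frechet_derivative ?fa (at ((x + u *\<^sub>R a) + v *\<^sub>R b)) b) (at v)" if "0 \<le> v" "v \<le> s" for v
    using that in_U[of u v] u by (intro line fa) (auto simp: algebra_simps)
  then have "\<exists>v. 0 < v \<and> v < s \<and> ?fa ((x + u *\<^sub>R a) + s *\<^sub>R b) - ?fa ((x + u *\<^sub>R a) + 0 *\<^sub>R b) =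
     (s - 0) * frechet_derivative ?fa (at ((x + u *\<^sub>R a) + v *\<^sub>R b)) b"
    using \<open>0 < s\<close> by (intro MVT2) auto
  then obtain v where v: "0 < v" "v < s" "?fa ((x + u *\<^sub>R a) + s *\<^sub>R b) - ?fa (x + u *\<^sub>R a) =
     s * frechet_derivative ?fa (at ((x + u *\<^sub>R a) + v *\<^sub>R b)) b"
    by auto
  have "f (x + s *\<^sub>R a + s *\<^sub>R b) - f (x + s *\<^sub>R a) - f (x + s *\<^sub>R b) + f x = g s - g 0"
    by (simp add: g_def algebra_simps)
  also have "\<dots> = s * (s * frechet_derivative ?fa (at ((x + u *\<^sub>R a) + v *\<^sub>R b)) b)"
    using u v by (simp add: algebra_simps)
  finally show ?thesis
    using u(1,2) v(1,2) by (auto simp: power2_eq_square)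
qed

text \<open>Schwarz's theorem: both mixed derivatives are limits of the second difference quotient
  over a shrinking parallelogram.\<close>

lemma frechet_derivative_commute:
  fixes f :: "'a::euclidean_space \<Rightarrow> real"
  assumes "open U" "Ck_on 2 f U" "x \<in> U" "a \<in> Basis" "b \<in> Basis"
  shows "frechet_derivative (\<lambda>y. frechet_derivative f (at y) a) (at x) b
       = frechet_derivative (\<lambda>y. frechet_derivative f (at y) b) (at x) a" (is "?ab x = ?ba x")
proof (rule ccontr)
  assume ne: "?ab x \<noteq> ?ba x"
  \<comment> \<open>Half of the supposed gap: each mixed derivative is within \<open>e\<close> of
    its value at \<open>x\<close>, yet at two points of the parallelogram they share one
    value.\<close>
  define e where "e = \<bar>?ab x - ?ba x\<bar> / 2"
  have "e > 0" using ne by (simp add: e_def)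
  have C: "f differentiable at y" "(\<lambda>y. frechet_derivative f (at y) c) differentiable at y"
    "continuous_on U (\<lambda>x. frechet_derivative (\<lambda>y. frechet_derivative f (at y) c) (at x) c')"
    if "y \<in> U" "c \<in> Basis" "c' \<in> Basis" for y c c'
    using assms(2) that by (auto simp: numeral_2_eq_2)
  have cont: "continuous (at x) ?ab" "continuous (at x) ?ba"
    using C(3)[of x] assms by (auto simp: continuous_on_eq_continuous_at)
  obtain d1 where d1: "d1 > 0" "\<And>y. dist y x < d1 \<Longrightarrow> dist (?ab y) (?ab x) < e"
    using cont(1) \<open>e > 0\<close> unfolding continuous_at_eps_delta by blast
  obtain d2 where d2: "d2 > 0" "\<And>y. dist y x < d2 \<Longrightarrow> dist (?ba y) (?ba x) < e"
    using cont(2) \<open>e > 0\<close> unfolding continuous_at_eps_delta by blast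
  obtain d3 where d3: "d3 > 0" "ball x d3 \<subseteq> U"
    using assms(1,3) open_contains_ball by blast
  define d where "d = min d1 (min d2 d3)"
  have d: "d > 0" "d \<le> d1" "d \<le> d2" "d \<le> d3" using d1 d2 d3 by (auto simp: d_def)
  \<comment> \<open>Both sides of the parallelogram have length \<open>s\<close>, so its points are
    within 2 d / 3 of \<open>x\<close>.\<close>
  define s where "s = d / 3"
  have s: "0 < s" using d by (simp add: s_def)
  have near: "dist (x + u *\<^sub>R a + v *\<^sub>R b) x < d" if "0 \<le> u" "u \<le> s" "0 \<le> v" "v \<le> s" for u v
  proof -
    have "norm (u *\<^sub>R a + v *\<^sub>R b) \<le> norm (u *\<^sub>R a) + norm (v *\<^sub>R b)"
      by (rule norm_triangle_ineq)
    also have "\<dots> = u + v" using that assms by simp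
    also have "\<dots> < d" using that d by (simp add: s_def)
    finally show ?thesis by (simp add: dist_norm algebra_simps)
  qed
  have in_U: "x + u *\<^sub>R a + v *\<^sub>R b \<in> U" if "0 \<le> u" "u \<le> s" "0 \<le> v" "v \<le> s" for u v
    using near[OF that] d d3 by (auto simp: dist_commute)
  have "\<exists>u v. 0 < u \<and> u < s \<and> 0 < v \<and> v < s \<and>
    f (x + s *\<^sub>R a + s *\<^sub>R b) - f (x + s *\<^sub>R a) - f (x + s *\<^sub>R b) + f x = s\<^sup>2 * ?ab (x + u *\<^sub>R a + v *\<^sub>R b)"
    by (rule second_difference_MVT[where U = U]) (use s in_U C assms in auto)
  then obtain u v where 1: "0 < u" "u < s" "0 < v" "v < s"
    "f (x + s *\<^sub>R a + s *\<^sub>R b) - f (x + s *\<^sub>R a) - f (x + s *\<^sub>R b) + f x = s\<^sup>2 * ?ab (x + u *\<^sub>R a + v *\<^sub>R b)"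
    by blast
  have in_U': "x + u *\<^sub>R b + v *\<^sub>R a \<in> U" if "0 \<le> u" "u \<le> s" "0 \<le> v" "v \<le> s" for u v
    using in_U[of v u] that by (simp add: algebra_simps)
  have "\<exists>v u. 0 < v \<and> v < s \<and> 0 < u \<and> u < s \<and>
    f (x + s *\<^sub>R b + s *\<^sub>R a) - f (x + s *\<^sub>R b) - f (x + s *\<^sub>R a) + f x = s\<^sup>2 * ?ba (x + v *\<^sub>R b + u *\<^sub>R a)"
    by (rule second_difference_MVT[where U = U]) (use s in_U' C assms in auto)
  then obtain v' u' where 2: "0 < u'" "u' < s" "0 < v'" "v' < s"
    "f (x + s *\<^sub>R b + s *\<^sub>R a) - f (x + s *\<^sub>R b) - f (x + s *\<^sub>R a) + f x = s\<^sup>2 * ?ba (x + v' *\<^sub>R b + u' *\<^sub>R a)"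
    by blast
  have "s\<^sup>2 * ?ab (x + u *\<^sub>R a + v *\<^sub>R b) = s\<^sup>2 * ?ba (x + u' *\<^sub>R a + v' *\<^sub>R b)"
    using 1(5) 2(5) by (simp add: algebra_simps)
  then have eq: "?ab (x + u *\<^sub>R a + v *\<^sub>R b) = ?ba (x + u' *\<^sub>R a + v' *\<^sub>R b)"
    using s by simp
  have "dist (?ab x) (?ab (x + u *\<^sub>R a + v *\<^sub>R b)) < e" "dist (?ba x) (?ba (x + u' *\<^sub>R a + v' *\<^sub>R b)) < e"
    using near[of u v] near[of u' v'] 1 2 d by (auto intro!: d1 d2 simp: dist_commute[of "?ab x"] dist_commute[of "?ba x"])
  then have "dist (?ab x) (?ba x) < e + e"
    unfolding eq by (rule dist_triangle_less_add)
  then show False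
    by (simp add: e_def dist_real_def)
qed

section \<open>Gradients of functions smooth away from the origin\<close>

definition grad :: "('a::euclidean_space \<Rightarrow> real) \<Rightarrow> 'a \<Rightarrow> 'a" where
  "grad f x = (\<Sum>b\<in>Basis. frechet_derivative f (at x) b *\<^sub>R b)"

definition hess :: "('a::euclidean_space \<Rightarrow> real) \<Rightarrow> 'a \<Rightarrow> 'a \<Rightarrow> 'a" where
  "hess f x = frechet_derivative (grad f) (at x)"

text \<open>The punctured space is where \<open>norm\<close> and \<open>sgn\<close> are smooth,
  hence the natural domain of radial extensions; the class is closed under products and components
  of gradients.\<close>

definition smooth0 :: "('a::euclidean_space \<Rightarrow> real) \<Rightarrow> bool" where
  "smooth0 f \<longleftrightarrow> (\<forall>k. Ck_on k f (- {0}))"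

lemma grad_works:
  assumes "f differentiable at x"
  shows "(f has_derivative (\<lambda>h. grad f x \<bullet> h)) (at x)"
proof (rule has_derivative_eq_rhs)
  show d: "(f has_derivative frechet_derivative f (at x)) (at x)"
    using assms frechet_derivative_works by blast
  have l: "linear (frechet_derivative f (at x))"
    using d has_derivative_linear by blast
  show "frechet_derivative f (at x) = (\<lambda>h. grad f x \<bullet> h)"
  proof
    fix h
    have "frechet_derivative f (at x) h = frechet_derivative f (at x) (\<Sum>b\<in>Basis. (h \<bullet> b) *\<^sub>R b)"
      by (simp add: euclidean_representation)
    also have "\<dots> = grad f x \<bullet> h"
      by (simp add: linear_sum[OF l] linear_cmul[OF l] grad_def inner_sum_left inner_commute[of h] mult.commute)
    finally show "frechet_derivative f (at x) h = grad f x \<bullet> h" .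
  qed
qed

lemma grad_eqI:
  assumes "(f has_derivative (\<lambda>h. v \<bullet> h)) (at x)"
  shows "grad f x = v"
proof -
  have "(f has_derivative (\<lambda>h. grad f x \<bullet> h)) (at x)"
    using assms by (intro grad_works) (rule differentiableI)
  then have "(\<lambda>h. grad f x \<bullet> h) = (\<lambda>h. v \<bullet> h)"
    using assms has_derivative_unique by blast
  then show ?thesis
    unfolding fun_eq_iff vector_eq_rdot .
qed

lemma grad_cong:
  assumes "open U" "x \<in> U" "\<And>y. y \<in> U \<Longrightarrow> f y = g y" "f differentiable at x"
  shows "grad f x = grad g x"
  using frechet_derivative_transform_within_open[OF assms(4,1,2,3)] by (simp add: grad_def)

lemma grad_add:
  "f differentiable at x \<Longrightarrow> g differentiable at x \<Longrightarrow> grad (\<lambda>x. f x + g x) x = grad f x + grad g x"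
  by (rule grad_eqI) (auto intro!: derivative_eq_intros grad_works simp: inner_add_left)

lemma grad_diff:
  "f differentiable at x \<Longrightarrow> g differentiable at x \<Longrightarrow> grad (\<lambda>x. f x - g x) x = grad f x - grad g x"
  by (rule grad_eqI) (auto intro!: derivative_eq_intros grad_works simp: inner_diff_left)

lemma grad_mult:
  "f differentiable at x \<Longrightarrow> g differentiable at x \<Longrightarrow>
    grad (\<lambda>x. f x * g x) x = f x *\<^sub>R grad g x + g x *\<^sub>R grad f x"
  by (rule grad_eqI) (auto intro!: derivative_eq_intros grad_works simp: inner_add_left)

lemma grad_inner_const: "grad (\<lambda>x. x \<bullet> c) x = c"
  by (rule grad_eqI) (auto intro!: derivative_eq_intros simp: inner_commute)

lemma grad_const: "grad (\<lambda>x. c) x = 0"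
  by (rule grad_eqI) simp

lemma grad_norm: "x \<noteq> 0 \<Longrightarrow> grad norm x = sgn x"
  by (rule grad_eqI) (auto simp: inner_commute dest: has_derivative_norm)

lemma smooth0_differentiable: "smooth0 f \<Longrightarrow> x \<noteq> 0 \<Longrightarrow> f differentiable at x"
proof -
  assume "smooth0 f" "x \<noteq> 0"
  then have "Ck_on (Suc 0) f (- {0})" unfolding smooth0_def by blast
  then show ?thesis using \<open>x \<noteq> 0\<close> by simp
qed

lemmas smooth0_grad_works = grad_works[OF smooth0_differentiable]

lemma smooth0_continuous_on: "smooth0 f \<Longrightarrow> continuous_on (- {0}) f"
  unfolding smooth0_def by (metis Ck_on.simps(1))

lemma smooth0_const: "smooth0 (\<lambda>x. c)"
  unfolding smooth0_def by (auto intro: Ck_on_const)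

lemma smooth0_inner_const: "smooth0 (\<lambda>x. x \<bullet> c)"
  unfolding smooth0_def by (auto intro!: Ck_on_linear bounded_linear_intros)

lemma smooth0_add: "smooth0 f \<Longrightarrow> smooth0 g \<Longrightarrow> smooth0 (\<lambda>x. f x + g x)"
  unfolding smooth0_def by (auto intro: Ck_on_add)

lemma smooth0_mult: "smooth0 f \<Longrightarrow> smooth0 g \<Longrightarrow> smooth0 (\<lambda>x. f x * g x)"
  unfolding smooth0_def by (auto intro: Ck_on_mult)

lemma smooth0_diff: "smooth0 f \<Longrightarrow> smooth0 g \<Longrightarrow> smooth0 (\<lambda>x. f x - g x)"
  using smooth0_add[of f "\<lambda>x. -1 * g x"] smooth0_mult[OF smooth0_const, of g "-1"] by simp

lemma smooth0_sum: "(\<And>i. i \<in> I \<Longrightarrow> smooth0 (f i)) \<Longrightarrow> smooth0 (\<lambda>x. \<Sum>i\<in>I. f i x)"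
  unfolding smooth0_def by (auto intro: Ck_on_sum)

lemma smooth0_cong: "(\<And>x. x \<noteq> 0 \<Longrightarrow> f x = g x) \<Longrightarrow> smooth0 f \<Longrightarrow> smooth0 g"
  unfolding smooth0_def by (auto intro: Ck_on_cong[of "- {0}", rotated 2])

text \<open>The norm is its square, a polynomial, times the inverse norm.\<close>

lemma smooth0_norm: "smooth0 (norm :: 'a::euclidean_space \<Rightarrow> real)"
proof (rule smooth0_cong)
  have "smooth0 (\<lambda>x::'a. inverse (norm x) ^ 1)"
    unfolding smooth0_def using Ck_on_inverse_norm_power by blast
  moreover have "smooth0 (\<lambda>x::'a. \<Sum>b\<in>Basis. (x \<bullet> b) * (x \<bullet> b))"
    by (intro smooth0_sum smooth0_mult smooth0_inner_const)
  ultimately show "smooth0 (\<lambda>x::'a. (\<Sum>b\<in>Basis. (x \<bullet> b) * (x \<bullet> b)) * inverse (norm x) ^ 1)"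
    by (intro smooth0_mult)
  fix x :: 'a assume "x \<noteq> 0"
  then show "(\<Sum>b\<in>Basis. (x \<bullet> b) * (x \<bullet> b)) * inverse (norm x) ^ 1 = norm x"
    by (simp add: euclidean_inner[symmetric] dot_square_norm power2_eq_square)
qed

lemma smooth0_grad_inner:
  assumes "smooth0 f"
  shows "smooth0 (\<lambda>x. grad f x \<bullet> c)"
proof (rule smooth0_cong)
  show "smooth0 (\<lambda>x. \<Sum>b\<in>Basis. frechet_derivative f (at x) b * (b \<bullet> c))"
  proof (intro smooth0_sum smooth0_mult smooth0_const)
    fix b :: 'a assume "b \<in> Basis"
    have "Ck_on (Suc k) f (- {0})" for k
      using assms smooth0_def by blast
    then show "smooth0 (\<lambda>x. frechet_derivative f (at x) b)"
      using \<open>b \<in> Basis\<close> unfolding smooth0_def by simp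
  qed
qed (simp add: grad_def inner_sum_left)

lemma grad_has_derivative:
  assumes "smooth0 f" "x \<noteq> 0"
  shows "(grad f has_derivative hess f x) (at x)"
proof -
  have "(\<lambda>x. grad f x \<bullet> b) differentiable at x" for b
    using smooth0_differentiable smooth0_grad_inner assms by blast
  then have "grad f differentiable at x"
    using differentiable_componentwise_within[of "grad f" x UNIV] by simp
  then show ?thesis
    using frechet_derivative_works by (auto simp: hess_def)
qed

lemma linear_hess: "smooth0 f \<Longrightarrow> x \<noteq> 0 \<Longrightarrow> linear (hess f x)"
  using grad_has_derivative has_derivative_linear by blast

lemma grad_grad_inner:
  assumes "smooth0 f" "x \<noteq> 0"
  shows "grad (\<lambda>y. grad f y \<bullet> c) x \<bullet> v = hess f x v \<bullet> c"
proof -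
  have "((\<lambda>y. grad f y \<bullet> c) has_derivative (\<lambda>v. hess f x v \<bullet> c)) (at x)"
    using grad_has_derivative[OF assms] by (rule has_derivative_inner_left)
  from fun_cong[OF has_derivative_unique[OF this smooth0_grad_works[OF smooth0_grad_inner[OF assms(1)] assms(2)]], of v]
  show ?thesis by simp
qed

lemma hess_sym:
  fixes f :: "'a::euclidean_space \<Rightarrow> real"
  assumes "smooth0 f" "x \<noteq> 0"
  shows "hess f x u \<bullet> v = hess f x v \<bullet> u"
proof -
  have l: "linear (hess f x)" by (rule linear_hess[OF assms])
  have C: "Ck_on 2 f (- {0})" using assms smooth0_def by blast
  have fd: "frechet_derivative f (at y) c = grad f y \<bullet> c" if "y \<noteq> 0" for y c
    using frechet_derivative_at[OF smooth0_grad_works[OF assms(1) that]] by metis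
  have fd2: "frechet_derivative (\<lambda>y. frechet_derivative f (at y) c) (at x) d = hess f x d \<bullet> c"
    if "c \<in> Basis" for c d
  proof -
    have "((\<lambda>y. grad f y \<bullet> c) has_derivative (\<lambda>v. hess f x v \<bullet> c)) (at x)"
      using grad_has_derivative[OF assms] by (rule has_derivative_inner_left)
    then have "((\<lambda>y. frechet_derivative f (at y) c) has_derivative (\<lambda>v. hess f x v \<bullet> c)) (at x)"
      by (rule has_derivative_transform_within_open[of _ _ _ UNIV "- {0}"]) (use assms fd in auto)
    from frechet_derivative_at[OF this] show ?thesis by metis
  qed
  have B: "hess f x a \<bullet> b = hess f x b \<bullet> a" if "a \<in> Basis" "b \<in> Basis" for a b
    using frechet_derivative_commute[OF _ C _ that, of x] assms(2)
    unfolding fd2[OF that(1)] fd2[OF that(2)] by (simp add: open_Compl)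
  have exp: "hess f x u \<bullet> v = (\<Sum>a\<in>Basis. \<Sum>b\<in>Basis. (u \<bullet> a) * (v \<bullet> b) * (hess f x a \<bullet> b))" for u v
  proof -
    have "hess f x u \<bullet> v = hess f x (\<Sum>a\<in>Basis. (u \<bullet> a) *\<^sub>R a) \<bullet> (\<Sum>b\<in>Basis. (v \<bullet> b) *\<^sub>R b)"
      by (simp add: euclidean_representation)
    also have "\<dots> = (\<Sum>a\<in>Basis. \<Sum>b\<in>Basis. (u \<bullet> a) * (v \<bullet> b) * (hess f x a \<bullet> b))"
      by (simp only: linear_sum[OF l] linear_cmul[OF l] inner_sum_left inner_sum_right inner_scaleR_left inner_scaleR_right)
        (simp add: sum_distrib_left mult.assoc mult.left_commute[of "v \<bullet> _"], rule sum.swap)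
    finally show ?thesis .
  qed
  show ?thesis
    unfolding exp[of u v] exp[of v u]
    by (subst sum.swap) (intro sum.cong refl, simp add: B mult.commute[of "u \<bullet> _"])
qed

text \<open>Differentiation of the scaling identity. With \<open>c = 1\<close> the gradient of a
  function of degree zero has degree minus one; with \<open>c = t\<close> the gradient of a function
  of degree one has degree zero.\<close>

lemma grad_scaled:
  assumes "smooth0 f" "t > 0" "\<And>y. y \<noteq> 0 \<Longrightarrow> f (t *\<^sub>R y) = c * f y" "x \<noteq> 0"
  shows "t *\<^sub>R grad f (t *\<^sub>R x) = c *\<^sub>R grad f x"
proof -
  have nz: "t *\<^sub>R x \<noteq> 0" using assms by simp
  have "((\<lambda>y. t *\<^sub>R y) has_derivative (\<lambda>h. t *\<^sub>R h)) (at x)"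
    by (auto intro!: derivative_eq_intros)
  from has_derivative_compose[OF this smooth0_grad_works[OF assms(1) nz]]
  have "((\<lambda>y. f (t *\<^sub>R y)) has_derivative (\<lambda>h. (t *\<^sub>R grad f (t *\<^sub>R x)) \<bullet> h)) (at x)"
    by simp
  then have "((\<lambda>y. c * f y) has_derivative (\<lambda>h. (t *\<^sub>R grad f (t *\<^sub>R x)) \<bullet> h)) (at x)"
    by (rule has_derivative_transform_within_open[of _ _ _ UNIV "- {0}"]) (use assms in auto)
  then have "grad (\<lambda>y. c * f y) x = t *\<^sub>R grad f (t *\<^sub>R x)"
    by (rule grad_eqI)
  moreover have "grad (\<lambda>y. c * f y) x = c *\<^sub>R grad f x"
    using grad_mult[OF differentiable_const smooth0_differentiable[OF assms(1,4)], of c]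
    by (simp add: grad_const)
  ultimately show ?thesis by simp
qed

lemma euler_homogeneous:
  assumes "smooth0 f" "\<And>y t. y \<noteq> 0 \<Longrightarrow> t > 0 \<Longrightarrow> f (t *\<^sub>R y) = t ^ k * f y" "x \<noteq> 0"
  shows "grad f x \<bullet> x = real k * f x"
proof -
  have nz: "1 *\<^sub>R x \<noteq> 0" using assms by simp
  have "((\<lambda>t. t *\<^sub>R x) has_derivative (\<lambda>h. h *\<^sub>R x)) (at (1::real))"
    by (auto intro!: derivative_eq_intros)
  from has_derivative_compose[OF this smooth0_grad_works[OF assms(1) nz]]
  have "((\<lambda>t. f (t *\<^sub>R x)) has_derivative (\<lambda>h. h * (grad f x \<bullet> x))) (at 1)"
    by (simp add: mult.commute)
  then have "((\<lambda>t. t ^ k * f x) has_derivative (\<lambda>h. h * (grad f x \<bullet> x))) (at 1)"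
    by (rule has_derivative_transform_within_open[of _ _ _ UNIV "{0<..}"]) (use assms in auto)
  moreover have "((\<lambda>t::real. t ^ k * f x) has_derivative (\<lambda>h. h * (real k * f x))) (at 1)"
    by (auto intro!: derivative_eq_intros)
  ultimately have "(\<lambda>h::real. h * (grad f x \<bullet> x)) = (\<lambda>h. h * (real k * f x))"
    using has_derivative_unique by blast
  from fun_cong[OF this, of 1] show ?thesis by simp
qed


section \<open>Rotation generators\<close>

text \<open>\<open>rotd a f\<close> is the derivative of \<open>f\<close> along the rotations about the axis \<open>a\<close>.\<close>

definition rotd :: "real^3 \<Rightarrow> (real^3 \<Rightarrow> real) \<Rightarrow> real^3 \<Rightarrow> real" where
  "rotd a f x = grad f x \<bullet> cross3 a x"

lemma rotd_triple: "rotd a f x = a \<bullet> cross3 x (grad f x)"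
  by (simp add: rotd_def cross3_simps)

lemma rotd_mult:
  "f differentiable at x \<Longrightarrow> g differentiable at x \<Longrightarrow>
    rotd a (\<lambda>x. f x * g x) x = f x * rotd a g x + g x * rotd a f x"
  by (simp add: rotd_def grad_mult inner_add_left)

lemma smooth0_rotd:
  assumes "smooth0 f"
  shows "smooth0 (rotd a f)"
proof (rule smooth0_cong)
  show "smooth0 (\<lambda>x. \<Sum>b\<in>Basis. (grad f x \<bullet> b) * (x \<bullet> cross3 b a))"
    by (intro smooth0_sum smooth0_mult smooth0_grad_inner smooth0_inner_const assms)
  fix x :: "real^3"
  have "x \<bullet> cross3 b a = cross3 a x \<bullet> b" for b
    by (simp add: cross3_simps)
  then show "(\<Sum>b\<in>Basis. (grad f x \<bullet> b) * (x \<bullet> cross3 b a)) = rotd a f x"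
    by (simp add: rotd_def euclidean_inner[of "grad f x" "cross3 a x"])
qed

lemma grad_rotd:
  assumes "smooth0 f" "x \<noteq> 0"
  shows "grad (rotd a f) x \<bullet> v = hess f x v \<bullet> cross3 a x + grad f x \<bullet> cross3 a v"
proof -
  have l: "bounded_linear (cross3 a)"
    using bilinear_cross linear_conv_bounded_linear by (auto simp: bilinear_def)
  have "(rotd a f has_derivative (\<lambda>v. grad f x \<bullet> cross3 a v + hess f x v \<bullet> cross3 a x)) (at x)"
    unfolding rotd_def[abs_def]
    by (rule has_derivative_inner[OF grad_has_derivative[OF assms] bounded_linear_imp_has_derivative[OF l]])
  from fun_cong[OF has_derivative_unique[OF this smooth0_grad_works[OF smooth0_rotd[OF assms(1)] assms(2)]], of v]
  show ?thesis by simp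
qed

lemma rotd_rotd:
  assumes "smooth0 f" "x \<noteq> 0"
  shows "rotd a (rotd b f) x = hess f x (cross3 a x) \<bullet> cross3 b x + grad f x \<bullet> cross3 b (cross3 a x)"
  unfolding rotd_def[of a] grad_rotd[OF assms] ..

text \<open>The bracket relation of so(3): the second-order parts cancel by symmetry of the Hessian,
  and the first-order parts differ by the Jacobi identity for the cross product.\<close>

lemma rotd_commutator:
  assumes "smooth0 f" "x \<noteq> 0"
  shows "rotd a (rotd b f) x = rotd b (rotd a f) x - rotd (cross3 a b) f x"
proof -
  have "grad f x \<bullet> cross3 b (cross3 a x) = grad f x \<bullet> cross3 a (cross3 b x) - rotd (cross3 a b) f x"
    by (simp add: rotd_def cross3_simps)
  then show ?thesis
    unfolding rotd_rotd[OF assms] hess_sym[OF assms, of "cross3 a x"] by simp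
qed

lemma sum_Basis_3:
  fixes f :: "real^3 \<Rightarrow> 'b::comm_monoid_add"
  shows "(\<Sum>b\<in>Basis. f b) = f (axis 1 1) + f (axis 2 1) + f (axis 3 1)"
proof -
  have *: "(Basis::(real^3) set) = {axis 1 1, axis 2 1, axis 3 1}"
    by (auto simp: Basis_vec_def UNIV_3)
  show ?thesis unfolding * by (simp add: axis_eq_axis add.assoc)
qed

lemma hess_component:
  fixes f :: "real^3 \<Rightarrow> real"
  assumes "smooth0 f" "x \<noteq> 0"
  shows "hess f x v $ j = v $ 1 * hess f x (axis 1 1) $ j + v $ 2 * hess f x (axis 2 1) $ j + v $ 3 * hess f x (axis 3 1) $ j"
proof -
  have "v = v $ 1 *\<^sub>R axis 1 1 + v $ 2 *\<^sub>R axis 2 1 + v $ 3 *\<^sub>R axis 3 1"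
    by (simp add: vec_eq_iff forall_3 axis_def)
  then have "hess f x v = hess f x (v $ 1 *\<^sub>R axis 1 1 + v $ 2 *\<^sub>R axis 2 1 + v $ 3 *\<^sub>R axis 3 1)"
    by simp
  then show ?thesis
    using linear_hess[OF assms] by (simp add: linear_add linear_cmul)
qed

lemma hess_component_sym:
  fixes f :: "real^3 \<Rightarrow> real"
  assumes "smooth0 f" "x \<noteq> 0"
  shows "hess f x (axis i 1) $ j = hess f x (axis j 1) $ i"
  using hess_sym[OF assms, of "axis i 1" "axis j 1"] by (simp add: inner_axis inner_real_def)

text \<open>This puts the transport term in divergence form. In the product rule the Hessian of
  \<open>h\<close> is contracted with the antisymmetric map of crossing with \<open>x\<close>, which
  gives zero; the terms with derivatives of \<open>g\<close> add up to the triple product.\<close>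

lemma triple_product_eq_sum_rotd:
  assumes "smooth0 h" "g differentiable at x" "x \<noteq> 0"
  shows "x \<bullet> cross3 (grad g x) (grad h x) = (\<Sum>b\<in>Basis. rotd b (\<lambda>y. g y * (grad h y \<bullet> b)) x)"
proof -
  have "(\<Sum>b\<in>Basis. rotd b (\<lambda>y. g y * (grad h y \<bullet> b)) x) =
     (\<Sum>b\<in>Basis. g x * (hess h x (cross3 b x) \<bullet> b) + (grad h x \<bullet> b) * rotd b g x)"
    using assms by (intro sum.cong refl)
      (simp add: rotd_mult smooth0_differentiable smooth0_grad_inner, simp add: rotd_def grad_grad_inner)
  also have "\<dots> = x \<bullet> cross3 (grad g x) (grad h x)"
    unfolding sum_Basis_3 rotd_def inner_axis' inner_axis hess_component[OF assms(1,3), of "cross3 _ _"]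
    using hess_component_sym[OF assms(1,3), of 2 1] hess_component_sym[OF assms(1,3), of 3 1]
       hess_component_sym[OF assms(1,3), of 3 2]
    by (simp add: cross3_simps axis_def)
  finally show ?thesis ..
qed

definition lap :: "('a::euclidean_space \<Rightarrow> real) \<Rightarrow> 'a \<Rightarrow> real" where
  "lap f x = (\<Sum>b\<in>Basis. hess f x b \<bullet> b)"

text \<open>The sum of squared generators is the Casimir operator of so(3). On the unit sphere it
  equals the Euclidean Laplacian minus the second radial derivative minus twice the first one, and
  degree zero kills both radial terms.\<close>

lemma sum_rotd_rotd:
  fixes f :: "real^3 \<Rightarrow> real"
  assumes f: "smooth0 f" and x: "norm x = 1"
    and hom: "\<And>y t. y \<noteq> 0 \<Longrightarrow> t > 0 \<Longrightarrow> f (t *\<^sub>R y) = f y"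
  shows "(\<Sum>b\<in>Basis. rotd b (rotd b f) x) = lap f x"
proof -
  have x0: "x \<noteq> 0" using x by auto
  have E: "grad f y \<bullet> y = 0" if "y \<noteq> 0" for y
    using euler_homogeneous[OF f, of 0 y] hom that by simp
  \<comment> \<open>Differentiating Euler's identity along \<open>x\<close> gives the vanishing of
    the second radial derivative.\<close>
  have "((\<lambda>y. grad f y \<bullet> y) has_derivative (\<lambda>v. grad f x \<bullet> v + hess f x v \<bullet> x)) (at x)"
    by (rule has_derivative_inner[OF grad_has_derivative[OF f x0] has_derivative_ident])
  then have "((\<lambda>y. 0) has_derivative (\<lambda>v. grad f x \<bullet> v + hess f x v \<bullet> x)) (at x)"
    by (rule has_derivative_transform_within_open[of _ _ _ UNIV "- {0}"]) (use x0 E in auto)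
  then have "(\<lambda>v. grad f x \<bullet> v + hess f x v \<bullet> x) = (\<lambda>v. 0)"
    using has_derivative_unique[OF _ has_derivative_const] by blast
  from fun_cong[OF this, of x] have Hxx: "hess f x x \<bullet> x = 0"
    using E[OF x0] by simp
  have n: "x $ 1 * x $ 1 + x $ 2 * x $ 2 + x $ 3 * x $ 3 = 1"
    using x by (simp add: norm_eq_1 inner_vec_def sum_3)
  let ?h = "\<lambda>i j. hess f x (axis i 1) $ j"
  have "(\<Sum>b\<in>Basis. rotd b (rotd b f) x) =
    (x $ 1 * x $ 1 + x $ 2 * x $ 2 + x $ 3 * x $ 3) * (?h 1 1 + ?h 2 2 + ?h 3 3) - hess f x x \<bullet> x - 2 * (grad f x \<bullet> x)"
    unfolding sum_Basis_3 rotd_rotd[OF f x0] inner_vec_def sum_3 hess_component[OF f x0, of "cross3 _ _"]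
      hess_component[OF f x0, of x]
    using hess_component_sym[OF f x0, of 2 1] hess_component_sym[OF f x0, of 3 1]
       hess_component_sym[OF f x0, of 3 2]
    by (simp add: cross3_def axis_def algebra_simps)
  then show ?thesis
    unfolding n Hxx E[OF x0] by (simp add: lap_def sum_Basis_3 inner_axis)
qed


section \<open>Smooth functions on the sphere\<close>

lemma smooth_on_S2_imp_smooth0:
  assumes "smooth_on f S2"
  shows "smooth0 (\<lambda>x. f (sgn x))"
proof -
  obtain U F where F: "S2 \<subseteq> U" "\<And>k. Ck_on k F U" "\<And>x. x \<in> S2 \<Longrightarrow> F x = f x"
    using assms unfolding smooth_on_def by blast
  have "sgn y \<in> U" if "y \<noteq> 0" for y
    using F(1) norm_sgn[of y] that by auto
  then have "smooth0 (\<lambda>x. F (sgn x))"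
    unfolding smooth0_def by (auto intro!: Ck_on_compose[OF _ _ F(2)] Ck_on_sgn)
  then show ?thesis
    by (rule smooth0_cong[rotated]) (simp add: F(3) norm_sgn)
qed

lemma sgn_scaleR_pos: "t > 0 \<Longrightarrow> sgn (t *\<^sub>R y) = sgn (y::'a::real_normed_vector)"
  by (simp add: sgn_scaleR)

lemma sgrad_eq_grad: "sgrad f x = grad (\<lambda>y. f (sgn y)) x"
  by (simp add: sgrad_def grad_def)

text \<open>\<open>slaplace\<close> extends the gradient radially a second time before taking the
  divergence. Since the gradient of \<open>?F\<close> has degree minus one, this extension is
  \<open>norm y *\<^sub>R grad ?F y\<close>; differentiating the extra factor contributes only the
  radial derivative of \<open>?F\<close>, which is zero.\<close>

lemma slaplace_eq_lap:
  assumes "smooth_on f S2" "x \<in> S2"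
  shows "slaplace f x = lap (\<lambda>y. f (sgn y)) x"
proof -
  let ?F = "\<lambda>y. f (sgn y)"
  have F: "smooth0 ?F" by (rule smooth_on_S2_imp_smooth0[OF assms(1)])
  have x: "norm x = 1" "x \<noteq> 0" using assms by auto
  have "grad ?F (sgn y) = norm y *\<^sub>R grad ?F y" if "y \<noteq> 0" for y
  proof -
    have "inverse (norm y) *\<^sub>R grad ?F (inverse (norm y) *\<^sub>R y) = 1 *\<^sub>R grad ?F y"
      using that by (intro grad_scaled F) (auto simp: sgn_scaleR_pos)
    from arg_cong[OF this, of "\<lambda>v. norm y *\<^sub>R v"] that show ?thesis
      by (simp add: sgn_div_norm)
  qed
  then have *: "norm y *\<^sub>R grad ?F y = sgrad f (sgn y)" if "y \<noteq> 0" for y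
    using that by (simp add: sgrad_eq_grad)
  have "((\<lambda>y. norm y *\<^sub>R grad ?F y) has_derivative (\<lambda>v. norm x *\<^sub>R hess ?F x v + (v \<bullet> sgn x) *\<^sub>R grad ?F x)) (at x)"
    by (rule has_derivative_scaleR[OF has_derivative_norm[OF x(2)] grad_has_derivative[OF F x(2)]])
  then have "((\<lambda>y. sgrad f (sgn y)) has_derivative (\<lambda>v. norm x *\<^sub>R hess ?F x v + (v \<bullet> sgn x) *\<^sub>R grad ?F x)) (at x)"
    by (rule has_derivative_transform_within_open[of _ _ _ UNIV "- {0}"]) (use x * in auto)
  from frechet_derivative_at[OF this]
  have "slaplace f x = (\<Sum>b\<in>Basis. (hess ?F x b + (b \<bullet> x) *\<^sub>R grad ?F x) \<bullet> b)"
    unfolding slaplace_def sdiv_def using x by (simp add: sgn_div_norm fun_eq_iff)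
  also have "\<dots> = lap ?F x + grad ?F x \<bullet> x"
    by (simp add: lap_def inner_add_left sum.distrib euclidean_inner[of "grad ?F x" x] inner_commute[of x] mult.commute)
  also have "grad ?F x \<bullet> x = 0"
    using euler_homogeneous[OF F, of 0 x] x by (simp add: sgn_scaleR_pos)
  finally show ?thesis by simp
qed

lemma slaplace_eq_sum_rotd:
  assumes "smooth_on f S2" "x \<in> S2"
  shows "slaplace f x = (\<Sum>b\<in>Basis. rotd b (rotd b (\<lambda>y. f (sgn y))) x)"
  using assms slaplace_eq_lap sum_rotd_rotd[OF smooth_on_S2_imp_smooth0[OF assms(1)]]
  by (simp add: sgn_scaleR_pos)

section \<open>Integration over the sphere\<close>

abbreviation coord_box :: "(real \<times> real) set" where
  "coord_box \<equiv> cbox (0, - (pi / 2)) (2 * pi, pi / 2)"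

text \<open>As a gauge integral over the closed parameter box it admits Fubini, the fundamental
  theorem and Leibniz's rule directly. For continuous functions it is the integral against
  \<open>area\<close>.\<close>

definition sint :: "(real^3 \<Rightarrow> real) \<Rightarrow> real" where
  "sint f = integral coord_box (\<lambda>z. cos (snd z) * f (sph_coords z))"

lemma vector_3_eq_axis: "(vector [a, b, c] :: real^3) = a *\<^sub>R axis 1 1 + b *\<^sub>R axis 2 1 + c *\<^sub>R axis 3 1"
  by (simp add: vec_eq_iff forall_3 axis_def)

lemma sph_coords_eq: "sph_coords z = vector [cos (snd z) * cos (fst z), cos (snd z) * sin (fst z), sin (snd z)]"
  by (simp add: sph_coords_def case_prod_beta)

lemma norm_sph_coords [simp]: "norm (sph_coords z) = 1"
proof -
  have "sph_coords z \<bullet> sph_coords z = 1"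
    unfolding sph_coords_eq inner_vec_def sum_3 vector_3 inner_real_def
    using sin_cos_squared_add[of "fst z"] sin_cos_squared_add[of "snd z"] by algebra
  then show ?thesis by (simp add: norm_eq_1)
qed

lemma continuous_on_sph_coords: "continuous_on A sph_coords"
  unfolding sph_coords_eq[abs_def] vector_3_eq_axis by (intro continuous_intros)

lemma continuous_on_compose_sph:
  "continuous_on S2 f \<Longrightarrow> continuous_on A (\<lambda>z. f (sph_coords z))"
  by (rule continuous_on_compose2[OF _ continuous_on_sph_coords]) auto

lemma sph_coords_surj:
  assumes "x \<in> S2"
  shows "\<exists>z\<in>coord_box. sph_coords z = x"
proof -
  have n: "(x $ 1)\<^sup>2 + (x $ 2)\<^sup>2 + (x $ 3)\<^sup>2 = 1"
    using assms by (simp add: norm_eq_1 inner_vec_def sum_3 power2_eq_square)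
  then have x3: "-1 \<le> x $ 3" "x $ 3 \<le> 1"
    using abs_le_square_iff[of "x $ 3" 1] by (smt (verit, best) zero_le_power2 one_power2)+
  define t where "t = arcsin (x $ 3)"
  have t: "- (pi/2) \<le> t" "t \<le> pi/2" "sin t = x $ 3"
    using x3 arcsin_bounded[of "x $ 3"] by (auto simp: t_def)
  have c: "cos t \<ge> 0" using t by (intro cos_ge_zero) auto
  have c2: "(cos t)\<^sup>2 = (x $ 1)\<^sup>2 + (x $ 2)\<^sup>2"
    using n t sin_cos_squared_add[of t] by simp
  obtain p where p: "0 \<le> p" "p \<le> 2 * pi" "x $ 1 = cos t * cos p" "x $ 2 = cos t * sin p"
  proof (cases "cos t = 0")
    case True
    then show ?thesis using that[of 0] c2 sum_power2_eq_zero_iff[of "x $ 1" "x $ 2"] by simp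
  next
    case False
    have "(x $ 1 / cos t)\<^sup>2 + (x $ 2 / cos t)\<^sup>2 = 1"
      using False by (simp add: power_divide add_divide_distrib[symmetric] c2[symmetric])
    from sincos_total_2pi_le[OF this] show ?thesis
      using that False by (auto simp: field_simps)
  qed
  have "sph_coords (p, t) = x"
    using p t by (simp add: sph_coords_eq vec_eq_iff forall_3)
  moreover have "(p, t) \<in> coord_box" using p t by (simp add: mem_box Basis_prod_def)
  ultimately show ?thesis by blast
qed

section \<open>Elementary properties of the spherical integral\<close>

lemma sint_integrable:
  "continuous_on S2 f \<Longrightarrow> (\<lambda>z. cos (snd z) * f (sph_coords z)) integrable_on coord_box"
  by (intro integrable_continuous continuous_intros continuous_on_compose_sph)

lemma cos_nonneg_coord_box: "z \<in> coord_box \<Longrightarrow> 0 \<le> cos (snd z)"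
  by (cases z) (auto simp: mem_box Basis_prod_def intro!: cos_ge_zero)

lemma sint_cong: "(\<And>x. x \<in> S2 \<Longrightarrow> f x = g x) \<Longrightarrow> sint f = sint g"
  unfolding sint_def by (intro integral_cong) simp

lemma sint_add:
  "continuous_on S2 f \<Longrightarrow> continuous_on S2 g \<Longrightarrow> sint (\<lambda>x. f x + g x) = sint f + sint g"
  unfolding sint_def by (subst integral_add[symmetric]) (auto intro: sint_integrable simp: distrib_left)

lemma sint_diff:
  "continuous_on S2 f \<Longrightarrow> continuous_on S2 g \<Longrightarrow> sint (\<lambda>x. f x - g x) = sint f - sint g"
  unfolding sint_def by (subst integral_diff[symmetric]) (auto intro: sint_integrable simp: right_diff_distrib)

lemma sint_cmult: "sint (\<lambda>x. c * f x) = c * sint f"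
  unfolding sint_def by (subst integral_mult_right[symmetric]) (simp add: mult.left_commute)

lemma sint_minus: "sint (\<lambda>x. - f x) = - sint f"
  using sint_cmult[of "-1" f] by simp

lemma sint_sum:
  assumes "finite I" "\<And>i. i \<in> I \<Longrightarrow> continuous_on S2 (f i)"
  shows "sint (\<lambda>x. \<Sum>i\<in>I. f i x) = (\<Sum>i\<in>I. sint (f i))"
  using assms
proof (induction I rule: finite_induct)
  case empty
  then show ?case by (simp add: sint_def)
next
  case (insert i I)
  then show ?case by (simp add: sint_add continuous_on_sum)
qed

lemma sint_mono:
  assumes "continuous_on S2 f" "continuous_on S2 g" "\<And>x. x \<in> S2 \<Longrightarrow> f x \<le> g x"
  shows "sint f \<le> sint g"
  unfolding sint_def using assms
  by (intro integral_le sint_integrable mult_left_mono) (auto simp: cos_nonneg_coord_box)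

lemma sint_nonneg:
  assumes "continuous_on S2 f" "\<And>x. x \<in> S2 \<Longrightarrow> 0 \<le> f x"
  shows "0 \<le> sint f"
  using sint_mono[OF continuous_on_const assms(1), of 0] assms(2) by (simp add: sint_def)

lemma sint_eq_0_imp:
  assumes "continuous_on S2 f" "\<And>x. x \<in> S2 \<Longrightarrow> 0 \<le> f x" "sint f = 0" "x \<in> S2"
  shows "f x = 0"
proof -
  let ?g = "\<lambda>z. cos (snd z) * f (sph_coords z)"
  have cont: "continuous_on coord_box ?g"
    by (intro continuous_intros continuous_on_compose_sph assms)
  have ne: "box (0, - (pi / 2)) (2 * pi, pi / 2) \<noteq> {}"
    by (auto simp: box_ne_empty Basis_prod_def)
  have z: "?g z = 0" if "z \<in> coord_box" for z
    using integral_cbox_eq_0_iff[OF cont ne] assms that cos_nonneg_coord_box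
    unfolding sint_def by auto
  obtain p t where pt: "(p, t) \<in> coord_box" "sph_coords (p, t) = x"
    using sph_coords_surj[OF assms(4)] by auto
  have zero: "f (sph_coords (p, s)) = 0" if "s \<in> {- (pi/2)<..<pi/2}" for s
  proof -
    have "cos s \<noteq> 0" using that by (auto intro!: cos_gt_zero_pi less_imp_neq[symmetric])
    then show ?thesis using z[of "(p, s)"] that pt by (auto simp: mem_box Basis_prod_def)
  qed
  \<comment> \<open>The weight \<open>cos\<close> vanishes at the poles and says nothing there; the
    value is recovered by continuity along a meridian.\<close>
  have "continuous_on (closure {- (pi/2)<..<pi/2}) (\<lambda>s. f (sph_coords (p, s)))"
    by (rule continuous_on_compose2[OF assms(1)])
      (auto intro!: continuous_intros continuous_on_compose2[OF continuous_on_sph_coords[of UNIV]])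
  then have "f (sph_coords (p, t)) = 0"
    by (rule continuous_constant_on_closure) (use zero pt in \<open>auto simp: mem_box Basis_prod_def\<close>)
  then show ?thesis using pt by simp
qed

lemma area_lebesgue_integral:
  assumes "continuous_on S2 f"
  shows "(\<integral>x. f x \<partial>area) = sint f"
proof -
  have m1: "sph_coords \<in> measurable lborel (restrict_space borel S2)"
    using continuous_on_sph_coords[of UNIV]
    by (intro measurable_restrict_space2) (auto intro: borel_measurable_continuous_onI)
  have m2: "f \<in> borel_measurable (restrict_space borel S2)"
    by (rule borel_measurable_continuous_on_restrict[OF assms])
  let ?g = "\<lambda>z::real \<times> real. indicator coord_box z * cos (snd z)"
  have box: "coord_box = {0..2 * pi} \<times> {- (pi / 2)..pi / 2}"
    by (simp add: cbox_Pair_eq)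
  have g: "(\<lambda>(\<phi>, \<theta>). indicator ({0..2 * pi} \<times> {- (pi / 2)..pi / 2}) (\<phi>, \<theta>) * ennreal (cos \<theta>)) = (\<lambda>z. ennreal (?g z))"
    unfolding box[symmetric] by (auto simp: fun_eq_iff indicator_def)
  have g0: "0 \<le> ?g z" for z
    using cos_nonneg_coord_box[of z] by (auto simp: indicator_def)
  have "(\<lambda>z::real \<times> real. cos (snd z)) \<in> borel_measurable borel"
    by (intro borel_measurable_continuous_onI continuous_intros)
  then have gm: "?g \<in> borel_measurable lborel"
    by (intro borel_measurable_times borel_measurable_indicator) auto
  have "(\<integral>x. f x \<partial>area) = (\<integral>z. f (sph_coords z) \<partial>density lborel (\<lambda>z. ennreal (?g z)))"
    unfolding area_def g by (rule integral_distr) (use m1 m2 in simp_all)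
  also have "\<dots> = (\<integral>z. ?g z *\<^sub>R f (sph_coords z) \<partial>lborel)"
    by (rule integral_density) (use m1 m2 gm g0 in simp_all)
  also have "\<dots> = set_lebesgue_integral lborel coord_box (\<lambda>z. cos (snd z) * f (sph_coords z))"
    unfolding set_lebesgue_integral_def by (simp add: mult.assoc)
  also have "\<dots> = sint f"
    unfolding sint_def
    by (intro set_borel_integral_eq_integral borel_integrable_compact[unfolded set_integrable_def[symmetric]])
      (auto intro!: continuous_intros continuous_on_compose_sph assms simp: set_integrable_def borel_integrable_compact)
  finally show ?thesis .
qed

lemma has_derivative_sph_coords:
  "(sph_coords has_derivative (\<lambda>h. fst h *\<^sub>R vector [- (cos (snd z) * sin (fst z)), cos (snd z) * cos (fst z), 0]
     + snd h *\<^sub>R vector [- (sin (snd z) * cos (fst z)), - (sin (snd z) * sin (fst z)), cos (snd z)])) (at z)"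
  unfolding sph_coords_eq[abs_def] vector_3_eq_axis
  by (auto intro!: derivative_eq_intros simp: fun_eq_iff vec_eq_iff forall_3 axis_def algebra_simps)

text \<open>In spherical coordinates \<open>cos \<theta> rotd a f\<close> is the divergence of \<open>(P f, Q f)\<close> below; the first
  component is periodic and the second one vanishes at the poles.\<close>

lemma sint_rotd:
  assumes diff: "\<And>x. x \<in> S2 \<Longrightarrow> f differentiable at x" and cont: "continuous_on S2 (grad f)"
  shows "sint (rotd a f) = 0"
proof -
  \<comment> \<open>\<open>P\<close> and \<open>Q\<close> are the components of
    \<open>cos (snd z) *\<^sub>R cross3 a (sph_coords z)\<close> in the coordinate frame
    \<open>V1\<close>, \<open>V2\<close>. Their derivatives \<open>P'\<close> and
    \<open>- P'\<close> cancel, which expresses that rotations preserve area; hence the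
    undifferentiated terms drop out of \<open>g1 + g2\<close>.\<close>
  define P where "P z = a $ 3 * cos (snd z) - (a $ 1 * cos (fst z) + a $ 2 * sin (fst z)) * sin (snd z)" for z :: "real \<times> real"
  define P' where "P' z = (a $ 1 * sin (fst z) - a $ 2 * cos (fst z)) * sin (snd z)" for z :: "real \<times> real"
  define Q where "Q z = (a $ 1 * sin (fst z) - a $ 2 * cos (fst z)) * cos (snd z)" for z :: "real \<times> real"
  define F where "F z = f (sph_coords z)" for z
  define V1 where "V1 z = (vector [- (cos (snd z) * sin (fst z)), cos (snd z) * cos (fst z), 0] :: real^3)" for z :: "real \<times> real"
  define V2 where "V2 z = (vector [- (sin (snd z) * cos (fst z)), - (sin (snd z) * sin (fst z)), cos (snd z)] :: real^3)" for z :: "real \<times> real"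
  define g1 where "g1 z = P' z * F z + P z * (grad f (sph_coords z) \<bullet> V1 z)" for z
  define g2 where "g2 z = Q z * (grad f (sph_coords z) \<bullet> V2 z) - P' z * F z" for z
  have F': "(F has_derivative (\<lambda>h. grad f (sph_coords z) \<bullet> (fst h *\<^sub>R V1 z + snd h *\<^sub>R V2 z))) (at z)" for z
    unfolding F_def[abs_def] V1_def V2_def
    by (rule has_derivative_compose[OF has_derivative_sph_coords grad_works[OF diff]]) simp
  have F1: "((\<lambda>u. F (u, v)) has_real_derivative grad f (sph_coords (u, v)) \<bullet> V1 (u, v)) (at u)" for u v
  proof -
    have "((\<lambda>u. (u, v)) has_derivative (\<lambda>h. (h, 0))) (at u)" by (auto intro!: derivative_eq_intros)
    from has_derivative_compose[OF this F'] show ?thesis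
      by (simp add: has_field_derivative_def mult.commute[of _ "_ \<bullet> _"])
  qed
  have F2: "((\<lambda>v. F (u, v)) has_real_derivative grad f (sph_coords (u, v)) \<bullet> V2 (u, v)) (at v)" for u v
  proof -
    have "((\<lambda>v. (u, v)) has_derivative (\<lambda>h. (0, h))) (at v)" by (auto intro!: derivative_eq_intros)
    from has_derivative_compose[OF this F'] show ?thesis
      by (simp add: has_field_derivative_def mult.commute[of _ "_ \<bullet> _"])
  qed
  have fc: "continuous_on S2 f"
    using diff by (auto intro!: continuous_at_imp_continuous_on differentiable_imp_continuous_within)
  have cF: "continuous_on A F" for A
    unfolding F_def by (rule continuous_on_compose_sph[OF fc])
  have cG: "continuous_on A (\<lambda>z. grad f (sph_coords z))" for A
    by (rule continuous_on_compose2[OF cont continuous_on_sph_coords]) auto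
  have c1: "continuous_on A g1" for A
    unfolding g1_def P_def P'_def V1_def vector_3_eq_axis by (intro continuous_intros cF cG)
  have c2: "continuous_on A g2" for A
    unfolding g2_def Q_def P'_def V2_def vector_3_eq_axis by (intro continuous_intros cF cG)
  have P1: "((\<lambda>u. P (u, v)) has_real_derivative P' (u, v)) (at u)" for u v
    unfolding P_def P'_def fst_conv snd_conv by (auto intro!: derivative_eq_intros simp: algebra_simps)
  have Q2: "((\<lambda>v. Q (u, v)) has_real_derivative - P' (u, v)) (at v)" for u v
    unfolding Q_def P'_def fst_conv snd_conv by (auto intro!: derivative_eq_intros simp: algebra_simps)
  have G1: "((\<lambda>u. P (u, v) * F (u, v)) has_real_derivative g1 (u, v)) (at u)" for u v
    using DERIV_mult[OF P1 F1] by (simp add: g1_def mult.commute)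
  have G2: "((\<lambda>v. Q (u, v) * F (u, v)) has_real_derivative g2 (u, v)) (at v)" for u v
    using DERIV_mult[OF Q2 F2] by (simp add: g2_def mult.commute add.commute)
  have "((\<lambda>u. g1 (u, v)) has_integral (P (2 * pi, v) * F (2 * pi, v) - P (0, v) * F (0, v))) {0..2 * pi}" for v
    by (rule fundamental_theorem_of_calculus)
      (simp_all add: has_real_derivative_iff_has_vector_derivative[symmetric] has_field_derivative_at_within[OF G1])
  moreover have "P (2 * pi, v) * F (2 * pi, v) - P (0, v) * F (0, v) = 0" for v
    by (simp add: P_def F_def sph_coords_eq)
  ultimately have i1: "integral {0..2 * pi} (\<lambda>u. g1 (u, v)) = 0" for v
    by (metis integral_unique)
  have "((\<lambda>v. g2 (u, v)) has_integral (Q (u, pi/2) * F (u, pi/2) - Q (u, - (pi/2)) * F (u, - (pi/2)))) {- (pi/2)..pi/2}" for u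
    by (rule fundamental_theorem_of_calculus)
      (simp_all add: has_real_derivative_iff_has_vector_derivative[symmetric] has_field_derivative_at_within[OF G2])
  moreover have "Q (u, pi/2) * F (u, pi/2) - Q (u, - (pi/2)) * F (u, - (pi/2)) = 0" for u
    by (simp add: Q_def)
  ultimately have i2: "integral {- (pi/2)..pi/2} (\<lambda>v. g2 (u, v)) = 0" for u
    by (metis integral_unique)
  have "integral coord_box g1 = integral (cbox 0 (2*pi)) (\<lambda>u. integral (cbox (- (pi/2)) (pi/2)) (\<lambda>v. g1 (u, v)))"
    by (rule integral_prod_continuous[OF c1])
  \<comment> \<open>The order of integration is swapped so that the periodic variable is integrated
    first.\<close>
  also have "\<dots> = integral (cbox (- (pi/2)) (pi/2)) (\<lambda>v. integral (cbox 0 (2*pi)) (\<lambda>u. g1 (u, v)))"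
    by (rule integral_swap_continuous) (simp add: c1)
  finally have I1: "integral coord_box g1 = 0" using i1 by simp
  have "integral coord_box g2 = integral (cbox 0 (2*pi)) (\<lambda>u. integral (cbox (- (pi/2)) (pi/2)) (\<lambda>v. g2 (u, v)))"
    by (rule integral_prod_continuous[OF c2])
  then have I2: "integral coord_box g2 = 0" using i2 by simp
  have "cos (snd z) * rotd a f (sph_coords z) = g1 z + g2 z" for z
  proof -
    have "sin (fst z) * sin (fst z) = 1 - cos (fst z) * cos (fst z)"
      using sin_cos_squared_add[of "fst z"] by (simp add: power2_eq_square)
    then have "cos (snd z) *\<^sub>R cross3 a (sph_coords z) = P z *\<^sub>R V1 z + Q z *\<^sub>R V2 z"
      unfolding P_def Q_def V1_def V2_def sph_coords_eq cross3_def vec_eq_iff forall_3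
      by (simp add: vector_3) algebra
    from arg_cong[OF this, of "\<lambda>v. grad f (sph_coords z) \<bullet> v"] show ?thesis
      by (simp add: rotd_def g1_def g2_def inner_add_right)
  qed
  then have "sint (rotd a f) = integral coord_box g1 + integral coord_box g2"
    unfolding sint_def by (subst integral_add[symmetric]) (auto intro: integrable_continuous c1 c2)
  then show ?thesis using I1 I2 by simp
qed

section \<open>Integration by parts with rotation generators\<close>

lemma S2_subset: "S2 \<subseteq> - {0}" by auto

lemma smooth0_continuous_S2: "smooth0 f \<Longrightarrow> continuous_on S2 f"
  using smooth0_continuous_on S2_subset continuous_on_subset by blast

lemma smooth0_grad_continuous_S2: "smooth0 f \<Longrightarrow> continuous_on S2 (grad f)"
  by (subst continuous_on_componentwise) (auto intro: smooth0_continuous_S2 smooth0_grad_inner)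

lemma sint_rotd_smooth0: "smooth0 f \<Longrightarrow> sint (rotd a f) = 0"
  by (rule sint_rotd) (auto intro: smooth0_differentiable smooth0_grad_continuous_S2)

lemma sint_rotd_by_parts:
  assumes "smooth0 f" "smooth0 g"
  shows "sint (\<lambda>x. f x * rotd a g x) = - sint (\<lambda>x. g x * rotd a f x)"
proof -
  have "0 = sint (rotd a (\<lambda>x. f x * g x))"
    using sint_rotd_smooth0 smooth0_mult assms by metis
  also have "\<dots> = sint (\<lambda>x. f x * rotd a g x + g x * rotd a f x)"
  proof (rule sint_cong)
    fix x assume "x \<in> S2"
    then have "x \<noteq> 0" by auto
    then show "rotd a (\<lambda>x. f x * g x) x = f x * rotd a g x + g x * rotd a f x"
      using assms by (intro rotd_mult smooth0_differentiable)
  qed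
  also have "\<dots> = sint (\<lambda>x. f x * rotd a g x) + sint (\<lambda>x. g x * rotd a f x)"
    by (intro sint_add smooth0_continuous_S2 smooth0_mult smooth0_rotd assms)
  finally show ?thesis by simp
qed

text \<open>With \<open>g\<close> a function of the vorticity this gives conservation of Casimirs,
  and with \<open>g\<close> a linear function times the vorticity the evolution of first moments.
  Only one derivative of \<open>g\<close> is assumed, because \<open>Phi\<close> has in general no
  second derivative at the ends of its quadratic range.\<close>

lemma sint_triple_product:
  assumes h: "smooth0 h" and g: "\<And>x. x \<in> S2 \<Longrightarrow> g differentiable at x" "continuous_on S2 (grad g)"
  shows "sint (\<lambda>x. x \<bullet> cross3 (grad g x) (grad h x)) = 0"
proof -
  let ?f = "\<lambda>b y. g y * (grad h y \<bullet> b)"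
  have x0: "x \<noteq> 0" if "x \<in> S2" for x :: "real^3" using that by auto
  have gc: "continuous_on S2 g"
    using g by (auto intro!: continuous_at_imp_continuous_on differentiable_imp_continuous_within)
  have sh: "smooth0 (\<lambda>y. grad h y \<bullet> b)" for b
    by (rule smooth0_grad_inner[OF h])
  have fd: "?f b differentiable at x" if "x \<in> S2" for b x
    using g(1)[OF that] smooth0_differentiable[OF sh x0[OF that]] by (intro differentiable_mult)
  have "continuous_on S2 (\<lambda>x. g x *\<^sub>R grad (\<lambda>y. grad h y \<bullet> b) x + (grad h x \<bullet> b) *\<^sub>R grad g x)" for b
    by (intro continuous_intros gc g(2) smooth0_grad_continuous_S2 sh h)
  then have fc: "continuous_on S2 (grad (?f b))" for b
  proof (rule continuous_on_eq)
    fix x assume x: "x \<in> S2"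
    show "g x *\<^sub>R grad (\<lambda>y. grad h y \<bullet> b) x + (grad h x \<bullet> b) *\<^sub>R grad g x = grad (?f b) x"
      by (rule grad_mult[OF g(1)[OF x] smooth0_differentiable[OF sh x0[OF x]], symmetric])
  qed
  have "sint (\<lambda>x. x \<bullet> cross3 (grad g x) (grad h x)) = sint (\<lambda>x. \<Sum>b\<in>Basis. rotd b (?f b) x)"
    by (rule sint_cong) (simp add: triple_product_eq_sum_rotd[OF h g(1)] x0)
  also have "\<dots> = (\<Sum>b\<in>Basis. sint (rotd b (?f b)))"
  proof (rule sint_sum)
    show "continuous_on S2 (rotd b (?f b))" for b
      unfolding rotd_def[abs_def]
      by (intro continuous_intros continuous_on_cross fc)
  qed simp
  also have "\<dots> = 0"
    by (intro sum.neutral ballI sint_rotd fd fc)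
  finally show ?thesis .
qed

text \<open>Self-adjointness of the Laplacian: each generator is antisymmetric and occurs
  twice.\<close>

lemma sint_sum_rotd_rotd_sym:
  assumes "smooth0 f" "smooth0 g"
  shows "sint (\<lambda>x. f x * (\<Sum>b\<in>Basis. rotd b (rotd b g) x)) = sint (\<lambda>x. (\<Sum>b\<in>Basis. rotd b (rotd b f) x) * g x)"
proof -
  have "sint (\<lambda>x. f x * (\<Sum>b\<in>Basis. rotd b (rotd b g) x)) = (\<Sum>b\<in>Basis. sint (\<lambda>x. f x * rotd b (rotd b g) x))"
    unfolding sum_distrib_left using assms
    by (intro sint_sum) (auto intro!: smooth0_continuous_S2 smooth0_mult smooth0_rotd)
  also have "\<dots> = (\<Sum>b\<in>Basis. sint (\<lambda>x. g x * rotd b (rotd b f) x))"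
  proof (rule sum.cong[OF refl])
    fix b :: "real^3"
    have "sint (\<lambda>x. f x * rotd b (rotd b g) x) = - sint (\<lambda>x. rotd b g x * rotd b f x)"
      by (intro sint_rotd_by_parts smooth0_rotd assms)
    also have "\<dots> = - sint (\<lambda>x. rotd b f x * rotd b g x)"
      by (simp add: mult.commute)
    also have "\<dots> = sint (\<lambda>x. g x * rotd b (rotd b f) x)"
      by (subst sint_rotd_by_parts) (auto intro: smooth0_rotd assms)
    finally show "sint (\<lambda>x. f x * rotd b (rotd b g) x) = sint (\<lambda>x. g x * rotd b (rotd b f) x)" .
  qed
  also have "\<dots> = sint (\<lambda>x. g x * (\<Sum>b\<in>Basis. rotd b (rotd b f) x))"
    unfolding sum_distrib_left using assms
    by (intro sint_sum[symmetric]) (auto intro!: smooth0_continuous_S2 smooth0_mult smooth0_rotd)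
  finally show ?thesis by (simp add: mult.commute)
qed

section \<open>The first eigenspace\<close>

lemma lap_eq_sum_grad: "smooth0 f \<Longrightarrow> x \<noteq> 0 \<Longrightarrow> lap f x = (\<Sum>b\<in>Basis. grad (\<lambda>y. grad f y \<bullet> b) x \<bullet> b)"
  by (simp add: lap_def grad_grad_inner)

lemma lap_mult:
  assumes f: "smooth0 f" and g: "smooth0 g" and x: "x \<noteq> 0"
  shows "lap (\<lambda>y. f y * g y) x = f x * lap g x + 2 * (grad f x \<bullet> grad g x) + g x * lap f x"
proof -
  note d = smooth0_differentiable[OF f] smooth0_differentiable[OF g]
    smooth0_differentiable[OF smooth0_grad_inner[OF f]] smooth0_differentiable[OF smooth0_grad_inner[OF g]]
  have "grad (\<lambda>y. grad (\<lambda>y. f y * g y) y \<bullet> b) x \<bullet> b =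
     f x * (hess g x b \<bullet> b) + 2 * ((grad f x \<bullet> b) * (grad g x \<bullet> b)) + g x * (hess f x b \<bullet> b)" for b
  proof -
    have "grad (\<lambda>y. grad (\<lambda>y. f y * g y) y \<bullet> b) x = grad (\<lambda>y. f y * (grad g y \<bullet> b) + g y * (grad f y \<bullet> b)) x"
    proof (rule grad_cong[of "- {0}"])
      show "grad (\<lambda>y. f y * g y) y \<bullet> b = f y * (grad g y \<bullet> b) + g y * (grad f y \<bullet> b)" if "y \<in> - {0}" for y
        using that by (simp add: grad_mult d inner_add_left)
      show "(\<lambda>y. grad (\<lambda>y. f y * g y) y \<bullet> b) differentiable at x"
        by (intro smooth0_differentiable[OF smooth0_grad_inner] smooth0_mult f g x)
    qed (use x in auto)
    also have "\<dots> \<bullet> b = f x * (hess g x b \<bullet> b) + 2 * ((grad f x \<bullet> b) * (grad g x \<bullet> b)) + g x * (hess f x b \<bullet> b)"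
      by (simp add: grad_add grad_mult d x differentiable_mult inner_add_left grad_grad_inner f g algebra_simps)
    finally show ?thesis .
  qed
  then have "lap (\<lambda>y. f y * g y) x = (\<Sum>b\<in>Basis. f x * (hess g x b \<bullet> b) +
      2 * ((grad f x \<bullet> b) * (grad g x \<bullet> b)) + g x * (hess f x b \<bullet> b))"
    by (simp add: lap_eq_sum_grad[OF smooth0_mult[OF f g] x])
  then show ?thesis
    by (simp add: sum.distrib sum_distrib_left[symmetric] lap_def euclidean_inner[of "grad f x" "grad g x"])
qed

text \<open>The value is the dimension minus one; it cancels the eigenvalue in \<open>E1\<close>
  when \<open>norm y * Y (sgn y)\<close> is shown to be harmonic.\<close>

lemma lap_norm:
  fixes x :: "real^3"
  assumes "norm x = 1"
  shows "lap norm x = 2"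
proof -
  have x: "x \<noteq> 0" using assms by auto
  have "grad (\<lambda>y. grad norm y \<bullet> b) x \<bullet> b = b \<bullet> b - (x \<bullet> b) * (x \<bullet> b)" for b
  proof -
    have d: "((\<lambda>y. inverse (norm y) ^ 1) has_derivative (\<lambda>h. (- x) \<bullet> h)) (at x)"
      using has_derivative_inverse_norm_power[OF x, of 1] assms by (simp add: inner_commute)
    have "grad (\<lambda>y. grad norm y \<bullet> b) x = grad (\<lambda>y. (y \<bullet> b) * inverse (norm y) ^ 1) x"
    proof (rule grad_cong[of "- {0}"])
      show "(\<lambda>y. grad norm y \<bullet> b) differentiable at x"
        by (intro smooth0_differentiable[OF smooth0_grad_inner] smooth0_norm x)
      show "grad norm y \<bullet> b = (y \<bullet> b) * inverse (norm y) ^ 1" if "y \<in> - {0}" for y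
        using that by (simp add: grad_norm sgn_div_norm divide_inverse mult.commute)
    qed (use x in auto)
    also have "\<dots> = (x \<bullet> b) *\<^sub>R grad (\<lambda>y. inverse (norm y) ^ 1) x + (inverse (norm x) ^ 1) *\<^sub>R grad (\<lambda>y. y \<bullet> b) x"
      by (rule grad_mult[OF bounded_linear_imp_differentiable[OF bounded_linear_inner_left] differentiableI[OF d]])
    also have "\<dots> = b - (x \<bullet> b) *\<^sub>R x"
      unfolding grad_eqI[OF d] grad_inner_const using assms by simp
    finally show ?thesis by (simp add: inner_diff_left)
  qed
  then have "lap norm x = (\<Sum>b\<in>(Basis::(real^3) set). b \<bullet> b) - x \<bullet> x"
    by (simp add: lap_eq_sum_grad[OF smooth0_norm x] sum_subtractf euclidean_inner[of x x])
  also have "\<dots> = 2"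
    using assms by (simp add: norm_eq_1)
  finally show ?thesis .
qed

text \<open>Energy argument: integrating by parts, the squared generators have total integral minus
  that of \<open>A\<close> times its Laplacian, that is zero. So every generator annihilates
  \<open>A\<close>, and its gradient is parallel to \<open>x\<close>; by Euler's identity it is also
  orthogonal to \<open>x\<close>. Scaling carries this off the unit sphere.\<close>

lemma homogeneous_0_grad_eq_0:
  fixes A :: "real^3 \<Rightarrow> real"
  assumes A: "smooth0 A" and hom: "\<And>y t. y \<noteq> 0 \<Longrightarrow> t > 0 \<Longrightarrow> A (t *\<^sub>R y) = A y"
    and lap: "\<And>x. norm x = 1 \<Longrightarrow> lap A x = 0" and y: "y \<noteq> 0"
  shows "grad A y = 0"
proof -
  have c: "continuous_on S2 (\<lambda>x. rotd b A x * rotd b A x)" for b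
    by (intro smooth0_continuous_S2 smooth0_mult smooth0_rotd A)
  have "sint (\<lambda>x. \<Sum>b\<in>Basis. rotd b A x * rotd b A x) = (\<Sum>b\<in>Basis. sint (\<lambda>x. rotd b A x * rotd b A x))"
    by (intro sint_sum c) simp
  also have "\<dots> = (\<Sum>b\<in>Basis. - sint (\<lambda>x. A x * rotd b (rotd b A) x))"
    by (intro sum.cong refl sint_rotd_by_parts smooth0_rotd A)
  also have "\<dots> = - sint (\<lambda>x. \<Sum>b\<in>Basis. A x * rotd b (rotd b A) x)"
    by (subst sint_sum) (auto intro!: smooth0_continuous_S2 smooth0_mult smooth0_rotd A simp: sum_negf)
  also have "\<dots> = - sint (\<lambda>x. 0)"
    by (intro arg_cong[of _ _ uminus] sint_cong)
      (simp add: sum_distrib_left[symmetric] sum_rotd_rotd[OF A _ hom] lap)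
  finally have s: "sint (\<lambda>x. \<Sum>b\<in>Basis. rotd b A x * rotd b A x) = 0"
    by (simp add: sint_def)
  have unit: "grad A x = 0" if x: "norm x = 1" for x
  proof -
    have x0: "x \<noteq> 0" using x by auto
    have "(\<Sum>b\<in>Basis. rotd b A x * rotd b A x) = 0"
      by (rule sint_eq_0_imp[OF _ _ s]) (use x c in \<open>auto intro!: continuous_on_sum sum_nonneg\<close>)
    then have "\<forall>b\<in>Basis. rotd b A x * rotd b A x = 0"
      by (subst (asm) sum_nonneg_eq_0_iff) auto
    then have "\<forall>b\<in>Basis. cross3 x (grad A x) \<bullet> b = 0"
      by (simp add: rotd_triple inner_commute)
    then have "cross3 x (grad A x) = 0"
      using euclidean_all_zero_iff by blast
    moreover have "x \<bullet> grad A x = 0"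
      using euler_homogeneous[OF A, of 0 x] hom x0 by (simp add: inner_commute)
    ultimately show ?thesis
      using norm_and_cross_eq_0[of x "grad A x"] x0 by blast
  qed
  have "inverse (norm y) *\<^sub>R grad A (inverse (norm y) *\<^sub>R y) = 1 *\<^sub>R grad A y"
    using y by (intro grad_scaled A) (auto simp: hom)
  then show ?thesis using unit[of "inverse (norm y) *\<^sub>R y"] y by simp
qed

text \<open>The harmonic extension \<open>u y = norm y * Y (sgn y)\<close> is homogeneous of degree one, so the components
  of its gradient are harmonic and homogeneous of degree zero, hence constant.\<close>

lemma E1_linear:
  assumes "Y \<in> E1"
  obtains a where "\<And>x. x \<in> S2 \<Longrightarrow> Y x = a \<bullet> x"
proof -
  have Y: "smooth_on Y S2" "\<And>x. x \<in> S2 \<Longrightarrow> slaplace Y x = - 2 * Y x"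
    using assms unfolding E1_def by fastforce+
  define F where "F y = Y (sgn y)" for y
  define u where "u y = norm y * F y" for y
  have F: "smooth0 F"
    unfolding F_def[abs_def] by (rule smooth_on_S2_imp_smooth0[OF Y(1)])
  have Fhom: "F (t *\<^sub>R y) = F y" if "t > 0" for t y
    using that by (simp add: F_def sgn_scaleR_pos)
  have u: "smooth0 u"
    unfolding u_def[abs_def] by (intro smooth0_mult smooth0_norm F)
  have uhom: "u (t *\<^sub>R y) = t * u y" if "t > 0" for t y
    using that by (simp add: u_def Fhom)
  define A where "A c y = grad u y \<bullet> c" for c y
  have A: "smooth0 (A c)" for c
    unfolding A_def[abs_def] by (rule smooth0_grad_inner[OF u])
  have Ahom: "A c (t *\<^sub>R y) = A c y" if "y \<noteq> 0" "t > 0" for c t y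
    using grad_scaled[OF u that(2) uhom[OF that(2)] that(1)] that by (simp add: A_def)
  have sum_A: "lap u y = (\<Sum>b\<in>Basis. grad (A b) y \<bullet> b)" if "y \<noteq> 0" for y
    unfolding A_def[abs_def] by (rule lap_eq_sum_grad[OF u that])
  have lap_unit: "lap u x = 0" if x: "norm x = 1" for x
  proof -
    have x0: "x \<noteq> 0" using x by auto
    have "lap u x = lap F x + 2 * (sgn x \<bullet> grad F x) + 2 * F x"
      using lap_mult[OF smooth0_norm F x0] x unfolding u_def[abs_def]
      by (simp add: lap_norm grad_norm x0)
    moreover have "lap F x = - 2 * Y x"
      using slaplace_eq_lap[OF Y(1), of x] Y(2)[of x] x unfolding F_def[abs_def] by simp
    moreover have "sgn x \<bullet> grad F x = 0"
      using euler_homogeneous[OF F, of 0 x] Fhom x0 x by (simp add: inner_commute sgn_div_norm)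
    moreover have "F x = Y x" using x by (simp add: F_def sgn_div_norm)
    ultimately show ?thesis by simp
  qed
  have lap_u: "lap u y = 0" if y: "y \<noteq> 0" for y
  proof -
    have sc: "inverse (norm y) *\<^sub>R grad (A b) (inverse (norm y) *\<^sub>R y) = grad (A b) y" for b
      using grad_scaled[OF A, of "inverse (norm y)" b 1 y] Ahom y by simp
    have "lap u y = (\<Sum>b\<in>Basis. (inverse (norm y) *\<^sub>R grad (A b) (inverse (norm y) *\<^sub>R y)) \<bullet> b)"
      unfolding sum_A[OF y] sc ..
    also have "\<dots> = inverse (norm y) * lap u (inverse (norm y) *\<^sub>R y)"
      using y by (subst sum_A) (auto simp: sum_distrib_left)
    finally show ?thesis using lap_unit[of "inverse (norm y) *\<^sub>R y"] y by simp
  qed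
  \<comment> \<open>The equation \<open>lap u = 0\<close> is differentiated along \<open>c\<close>;
    symmetry of the Hessians of \<open>u\<close> and of \<open>A b\<close> moves that derivative
    inside.\<close>
  have lap_A: "lap (A c) x = 0" if x: "x \<noteq> 0" for c x
  proof -
    have sym: "grad (A c) y \<bullet> b = grad (A b) y \<bullet> c" if "y \<noteq> 0" for b c y
      unfolding A_def[abs_def] grad_grad_inner[OF u that] by (rule hess_sym[OF u that])
    have "grad (\<lambda>y. grad (A c) y \<bullet> b) x \<bullet> b = grad (\<lambda>y. grad (A b) y \<bullet> b) x \<bullet> c" for b
    proof -
      have "grad (\<lambda>y. grad (A c) y \<bullet> b) x = grad (\<lambda>y. grad (A b) y \<bullet> c) x"
        by (rule grad_cong[of "- {0}"])
          (use x in \<open>auto intro!: sym smooth0_differentiable[OF smooth0_grad_inner[OF A]]\<close>)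
      then show ?thesis
        using hess_sym[OF A x, of b b c] by (simp add: grad_grad_inner[OF A x])
    qed
    then have "lap (A c) x = (\<Sum>b\<in>Basis. grad (\<lambda>y. grad (A b) y \<bullet> b) x \<bullet> c)"
      by (simp add: lap_eq_sum_grad[OF A x])
    moreover have "((\<lambda>y. \<Sum>b\<in>Basis. grad (A b) y \<bullet> b) has_derivative
        (\<lambda>h. \<Sum>b\<in>Basis. grad (\<lambda>y. grad (A b) y \<bullet> b) x \<bullet> h)) (at x)"
      by (intro has_derivative_sum smooth0_grad_works smooth0_grad_inner A x)
    then have "((\<lambda>y. 0) has_derivative
        (\<lambda>h. \<Sum>b\<in>Basis. grad (\<lambda>y. grad (A b) y \<bullet> b) x \<bullet> h)) (at x)"
      by (rule has_derivative_transform_within_open[of _ _ _ UNIV "- {0}"])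
        (use x lap_u sum_A in auto)
    then have "(\<lambda>h. \<Sum>b\<in>Basis. grad (\<lambda>y. grad (A b) y \<bullet> b) x \<bullet> h) = (\<lambda>h. 0)"
      using has_derivative_unique[OF _ has_derivative_const] by blast
    from fun_cong[OF this, of c] have "(\<Sum>b\<in>Basis. grad (\<lambda>y. grad (A b) y \<bullet> b) x \<bullet> c) = 0" .
    ultimately show ?thesis by simp
  qed
  have gradA: "grad (A c) y = 0" if "y \<noteq> 0" for c y
    by (rule homogeneous_0_grad_eq_0[OF A Ahom lap_A that]) auto
  define e :: "real^3" where "e = axis 1 1"
  have e: "e \<noteq> 0" by (simp add: e_def axis_eq_0_iff)
  \<comment> \<open>The punctured space is connected in dimension three, so a vanishing gradient
    forces a constant.\<close>
  have const: "A c y = A c e" if "y \<noteq> 0" for c y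
  proof (rule has_derivative_zero_unique_connected[of "- {0}" "A c" y])
    show "connected (- {0::real^3})" by (rule connected_punctured_universe) simp
    show "(A c has_derivative (\<lambda>x. 0)) (at x)" if "x \<in> - {0}" for x
      using smooth0_grad_works[OF A, of x c] gradA[of x c] that by auto
  qed (use that e in auto)
  show thesis
  proof
    fix x assume "x \<in> S2"
    then have x: "norm x = 1" "x \<noteq> 0" by auto
    have "Y x = u x" using x by (simp add: u_def F_def sgn_div_norm)
    also have "\<dots> = grad u x \<bullet> x"
      using euler_homogeneous[OF u, of 1 x] uhom x by simp
    also have "\<dots> = (\<Sum>b\<in>Basis. A b x * (x \<bullet> b))"
      by (simp add: euclidean_inner[of "grad u x" x] A_def)
    also have "\<dots> = (\<Sum>b\<in>Basis. A b e * (x \<bullet> b))"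
      by (simp add: const[OF x(2)])
    also have "\<dots> = (\<Sum>b\<in>Basis. A b e *\<^sub>R b) \<bullet> x"
      by (simp add: inner_sum_left inner_commute[of x])
    finally show "Y x = (\<Sum>b\<in>Basis. A b e *\<^sub>R b) \<bullet> x" .
  qed
qed


section \<open>Weak formulation of the Poisson equation\<close>

lemma smooth_on_S2_continuous:
  assumes "smooth_on f S2"
  shows "continuous_on S2 f"
  by (rule continuous_on_eq[OF smooth0_continuous_S2[OF smooth_on_S2_imp_smooth0[OF assms]]])
    (simp add: sgn_div_norm)

lemma continuous_on_abs_powr:
  fixes f :: "'a::topological_space \<Rightarrow> real"
  assumes "continuous_on S f" "0 < p"
  shows "continuous_on S (\<lambda>x. \<bar>f x\<bar> powr p)"
  by (rule continuous_on_powr'[OF continuous_on_rabs[OF assms(1)] continuous_on_const]) (use assms in auto)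

lemma Lp_norm_eq_sint:
  assumes "continuous_on S2 f" "0 < p"
  shows "Lp_norm p f = sint (\<lambda>x. \<bar>f x\<bar> powr p) powr (1 / p)"
  unfolding Lp_norm_def by (subst area_lebesgue_integral) (auto intro: continuous_on_abs_powr assms)

text \<open>In place of the Cauchy-Schwarz inequality, the pointwise bound of B d by e B^2 + d^2 / e
  is integrated, with the parameter e free.\<close>

lemma sint_mult_tendsto:
  assumes "continuous_on S2 k" "\<And>n. continuous_on S2 (w n)" "continuous_on S2 v"
    and "(\<lambda>n. Lp_norm 2 (\<lambda>x. w n x - v x)) \<longlonglongrightarrow> 0"
  shows "(\<lambda>n. sint (\<lambda>x. k x * w n x)) \<longlonglongrightarrow> sint (\<lambda>x. k x * v x)"
proof -
  define q where "q n = sint (\<lambda>x. (w n x - v x)\<^sup>2)" for n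
  have dc: "continuous_on S2 (\<lambda>x. w n x - v x)" for n
    by (intro continuous_intros assms)
  have q0: "q n \<ge> 0" for n
    unfolding q_def by (intro sint_nonneg continuous_intros dc) auto
  have "Lp_norm 2 (\<lambda>x. w n x - v x) = sqrt (q n)" for n
    by (subst Lp_norm_eq_sint[OF dc]) (simp_all add: q_def powr_half_sqrt q0[unfolded q_def])
  then have "(\<lambda>n. (sqrt (q n))\<^sup>2) \<longlonglongrightarrow> 0\<^sup>2"
    using assms(4) by (intro tendsto_power) simp
  then have q: "q \<longlonglongrightarrow> 0" using q0 by simp
  have "compact ((\<lambda>x. k x) ` S2)"
    by (intro compact_continuous_image assms) auto
  then obtain B where B: "\<And>x. x \<in> S2 \<Longrightarrow> \<bar>k x\<bar> \<le> B"
    using compact_imp_bounded bounded_iff by (metis image_eqI real_norm_def)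
  define S where "S = sint (\<lambda>x. 1)"
  have S: "S \<ge> 0" unfolding S_def by (intro sint_nonneg) auto
  have bound: "\<bar>sint (\<lambda>x. k x * w n x) - sint (\<lambda>x. k x * v x)\<bar> \<le> e * (S * B\<^sup>2) + q n / e" if e: "e > 0" for e n
  proof -
    have pt: "\<bar>k x * (w n x - v x)\<bar> \<le> e * B\<^sup>2 * 1 + (1 / e) * (w n x - v x)\<^sup>2" if "x \<in> S2" for x
    proof -
      define d where "d = \<bar>w n x - v x\<bar>"
      have "\<bar>k x * (w n x - v x)\<bar> \<le> B * d"
        unfolding d_def abs_mult by (intro mult_right_mono B that) auto
      also have "\<dots> \<le> e * B\<^sup>2 + (1 / e) * d\<^sup>2"
      proof -
        have "0 \<le> (e * B - d / 2)\<^sup>2 + d\<^sup>2 * (3/4)" by simp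
        then have "e * (B * d) \<le> e * (e * B\<^sup>2) + d\<^sup>2"
          by (simp add: power2_eq_square algebra_simps)
        then have "e * (B * d) \<le> e * (e * B\<^sup>2 + (1 / e) * d\<^sup>2)"
          using e by (simp add: distrib_left)
        then show ?thesis using e by simp
      qed
      finally show ?thesis by (simp add: d_def)
    qed
    have "sint (\<lambda>x. k x * w n x) - sint (\<lambda>x. k x * v x) = sint (\<lambda>x. k x * (w n x - v x))"
      by (subst sint_diff[symmetric]) (auto intro!: continuous_intros assms simp: right_diff_distrib)
    moreover have "sint (\<lambda>x. k x * (w n x - v x)) \<le> sint (\<lambda>x. e * B\<^sup>2 * 1 + (1 / e) * (w n x - v x)\<^sup>2)"
      by (intro sint_mono continuous_intros assms) (use pt in force)
    moreover have "- sint (\<lambda>x. k x * (w n x - v x)) \<le> sint (\<lambda>x. e * B\<^sup>2 * 1 + (1 / e) * (w n x - v x)\<^sup>2)"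
      unfolding sint_minus[symmetric] by (intro sint_mono continuous_intros assms) (use pt in force)
    moreover have "sint (\<lambda>x. e * B\<^sup>2 * 1 + (1 / e) * (w n x - v x)\<^sup>2) = e * B\<^sup>2 * S + (1 / e) * q n"
      unfolding S_def q_def using e
      by (subst sint_add) (auto intro!: continuous_intros assms simp: sint_cmult[symmetric])
    ultimately show ?thesis by (simp add: abs_le_iff algebra_simps del: right_diff_distrib_numeral)
  qed
  show ?thesis
  proof (rule LIMSEQ_I)
    fix r :: real assume r: "r > 0"
    \<comment> \<open>Chosen so that the area term is at most r / 2; the added 1 excludes division
      by zero. Then \<open>n\<close> is taken large for this \<open>e\<close>.\<close>
    define e where "e = r / (2 * (S * B\<^sup>2 + 1))"
    have SB: "S * B\<^sup>2 + 1 > 0" using S by (intro add_nonneg_pos mult_nonneg_nonneg) auto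
    have e: "e > 0" using r SB by (simp add: e_def)
    have "e * (S * B\<^sup>2) \<le> e * (S * B\<^sup>2 + 1)" using e by simp
    also have "\<dots> = r / 2" using SB by (simp add: e_def field_simps)
    finally have e1: "e * (S * B\<^sup>2) \<le> r / 2" .
    obtain N where N: "\<And>n. n \<ge> N \<Longrightarrow> norm (q n - 0) < e * r / 2"
      using LIMSEQ_D[OF q, of "e * r / 2"] e r by auto
    have "norm (sint (\<lambda>x. k x * w n x) - sint (\<lambda>x. k x * v x)) < r" if "n \<ge> N" for n
    proof -
      have "q n / e < r / 2" using N[OF that] e q0[of n] by (simp add: field_simps)
      then show ?thesis using bound[OF e, of n] e1 unfolding real_norm_def by linarith
    qed
    then show "\<exists>N. \<forall>n\<ge>N. norm (sint (\<lambda>x. k x * w n x) - sint (\<lambda>x. k x * v x)) < r" by blast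
  qed
qed

text \<open>One integration by parts leaves products of \<open>rotd b (rotd a f)\<close> with
  \<open>rotd b f\<close>. Commuting the generators turns each into half the \<open>rotd a\<close>
  derivative of a square, which integrates to zero, plus a bracket term; the bracket terms cancel in
  the sum over \<open>b\<close> because the structure constants are antisymmetric.\<close>

lemma sint_rotd_laplace:
  assumes f: "smooth0 f"
  shows "sint (\<lambda>x. (\<Sum>b\<in>Basis. rotd b (rotd b (rotd a f)) x) * f x) = 0"
proof -
  have s: "smooth0 (\<lambda>x. rotd b f x * rotd b f x)" for b
    by (intro smooth0_mult smooth0_rotd f)
  have "sint (\<lambda>x. (\<Sum>b\<in>Basis. rotd b (rotd b (rotd a f)) x) * f x) =
     sint (\<lambda>x. \<Sum>b\<in>Basis. f x * rotd b (rotd b (rotd a f)) x)"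
    by (simp add: sum_distrib_left mult.commute)
  also have "\<dots> = (\<Sum>b\<in>Basis. sint (\<lambda>x. f x * rotd b (rotd b (rotd a f)) x))"
    by (intro sint_sum) (auto intro!: smooth0_continuous_S2 smooth0_mult smooth0_rotd f)
  also have "\<dots> = (\<Sum>b\<in>Basis. - sint (\<lambda>x. rotd b (rotd a f) x * rotd b f x))"
    by (intro sum.cong refl sint_rotd_by_parts smooth0_rotd f)
  also have "\<dots> = - sint (\<lambda>x. \<Sum>b\<in>Basis. rotd b (rotd a f) x * rotd b f x)"
    by (subst sint_sum) (auto intro!: smooth0_continuous_S2 smooth0_mult smooth0_rotd f simp: sum_negf)
  also have "sint (\<lambda>x. \<Sum>b\<in>Basis. rotd b (rotd a f) x * rotd b f x) =
    sint (\<lambda>x. \<Sum>b\<in>Basis. (1/2) * rotd a (\<lambda>x. rotd b f x * rotd b f x) x)"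
  proof (rule sint_cong)
    fix x assume "x \<in> S2"
    then have x: "x \<noteq> 0" by auto
    have "rotd b (rotd a f) x * rotd b f x =
      (1/2) * rotd a (\<lambda>x. rotd b f x * rotd b f x) x - rotd (cross3 b a) f x * rotd b f x" for b
      unfolding rotd_commutator[OF f x, of b a]
      using smooth0_differentiable[OF smooth0_rotd[OF f] x] by (simp add: rotd_mult algebra_simps)
    moreover have "(\<Sum>b\<in>Basis. rotd (cross3 b a) f x * rotd b f x) = 0"
      unfolding rotd_triple sum_Basis_3 by (simp add: cross3_simps axis_def)
    ultimately show "(\<Sum>b\<in>Basis. rotd b (rotd a f) x * rotd b f x) =
      (\<Sum>b\<in>Basis. (1/2) * rotd a (\<lambda>x. rotd b f x * rotd b f x) x)"
      by (simp add: sum_subtractf)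
  qed
  also have "\<dots> = (\<Sum>b\<in>Basis. sint (\<lambda>x. (1/2) * rotd a (\<lambda>x. rotd b f x * rotd b f x) x))"
    by (intro sint_sum continuous_on_mult continuous_on_const smooth0_continuous_S2 smooth0_rotd s) simp
  also have "\<dots> = 0"
    by (simp only: sint_cmult sint_rotd_smooth0[OF s]) simp
  finally show ?thesis by simp
qed

text \<open>Only the weak equation \<open>\<integral> \<psi> \<Delta>\<phi> = - \<integral> \<zeta> \<phi>\<close> is extracted from \<open>is_G\<close>; it is tested with
  \<open>\<phi> = rotd a \<psi>\<close>, and the left side vanishes because \<open>rotd a\<close> is antisymmetric and commutes with \<open>\<Delta>\<close>.\<close>

lemma sint_mult_rotd_stream_function:
  assumes \<psi>: "smooth_on \<psi> S2" and G: "is_G 2 z \<psi>" and z: "continuous_on S2 z"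
  shows "sint (\<lambda>x. z x * rotd a (\<lambda>y. \<psi> (sgn y)) x) = 0"
proof -
  define f where "f y = \<psi> (sgn y)" for y
  have f: "smooth0 f" unfolding f_def[abs_def] by (rule smooth_on_S2_imp_smooth0[OF \<psi>])
  let ?k = "rotd a f"
  let ?K = "\<lambda>x. \<Sum>b\<in>Basis. rotd b (rotd b ?k) x"
  have k: "smooth0 ?k" by (rule smooth0_rotd[OF f])
  obtain v where v: "\<And>n. smooth_on (v n) S2" "(\<lambda>n. Lp_norm 2 (\<lambda>x. v n x - \<psi> x)) \<longlonglongrightarrow> 0"
    "(\<lambda>n. Lp_norm 2 (\<lambda>x. slaplace (v n) x - (- z x))) \<longlonglongrightarrow> 0"
    using G unfolding is_G_def W2_laplacian_def by blast
  have sv: "smooth0 (\<lambda>y. v n (sgn y))" for n by (rule smooth_on_S2_imp_smooth0[OF v(1)])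
  have "continuous_on S2 (\<lambda>x. \<Sum>b\<in>Basis. rotd b (rotd b (\<lambda>y. v n (sgn y))) x)" for n
    by (intro continuous_on_sum smooth0_continuous_S2 smooth0_rotd sv)
  then have cl: "continuous_on S2 (slaplace (v n))" for n
    by (rule continuous_on_eq) (simp add: slaplace_eq_sum_rotd[OF v(1)])
  have 1: "(\<lambda>n. sint (\<lambda>x. ?k x * slaplace (v n) x)) \<longlonglongrightarrow> sint (\<lambda>x. ?k x * (- z x))"
    by (rule sint_mult_tendsto[OF smooth0_continuous_S2[OF k] cl _ v(3)]) (intro continuous_intros z)
  have 2: "(\<lambda>n. sint (\<lambda>x. ?K x * v n x)) \<longlonglongrightarrow> sint (\<lambda>x. ?K x * \<psi> x)"
    by (rule sint_mult_tendsto[OF _ smooth_on_S2_continuous[OF v(1)] smooth_on_S2_continuous[OF \<psi>] v(2)])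
      (intro continuous_on_sum smooth0_continuous_S2 smooth0_rotd f)
  \<comment> \<open>Moving the Laplacian onto the smooth test function before passing to the limit
    makes the two L2 convergences in \<open>is_G\<close> sufficient.\<close>
  have "sint (\<lambda>x. ?k x * slaplace (v n) x) = sint (\<lambda>x. ?K x * v n x)" for n
  proof -
    have "sint (\<lambda>x. ?k x * slaplace (v n) x) = sint (\<lambda>x. ?k x * (\<Sum>b\<in>Basis. rotd b (rotd b (\<lambda>y. v n (sgn y))) x))"
      by (rule sint_cong) (simp add: slaplace_eq_sum_rotd[OF v(1)])
    also have "\<dots> = sint (\<lambda>x. ?K x * v n (sgn x))"
      by (rule sint_sum_rotd_rotd_sym[OF k sv])
    also have "\<dots> = sint (\<lambda>x. ?K x * v n x)"
      by (rule sint_cong) (simp add: sgn_div_norm)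
    finally show ?thesis .
  qed
  then have "sint (\<lambda>x. ?k x * (- z x)) = sint (\<lambda>x. ?K x * \<psi> x)"
    using LIMSEQ_unique[OF 1] 2 by simp
  also have "\<dots> = sint (\<lambda>x. ?K x * f x)"
    by (rule sint_cong) (simp add: f_def sgn_div_norm)
  also have "\<dots> = 0" by (rule sint_rotd_laplace[OF f])
  finally show ?thesis
    by (simp add: sint_minus f_def[abs_def] mult.commute)
qed

section \<open>The convex Casimir density\<close>

definition pos_powr :: "real \<Rightarrow> real \<Rightarrow> real" where
  "pos_powr q t = max t 0 powr q"

lemma has_real_derivative_pos_powr:
  assumes "1 < q"
  shows "(pos_powr q has_real_derivative q * pos_powr (q - 1) t) (at t)"
proof -
  consider "t > 0" | "t < 0" | "t = 0" by linarith
  then show ?thesis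
  proof cases
    case 1
    have "((\<lambda>t. t powr q) has_real_derivative q * t powr (q - 1)) (at t)"
      using 1 by (rule has_real_derivative_powr)
    then show ?thesis
      using 1 by (subst (asm) DERIV_cong_ev[OF refl _ refl, of _ "pos_powr q"])
        (auto simp: pos_powr_def eventually_nhds intro!: exI[of _ "{0<..}"])
  next
    case 2
    have "((\<lambda>t. 0) has_real_derivative 0) (at t)" by simp
    then show ?thesis
      using 2 by (subst (asm) DERIV_cong_ev[OF refl _ refl, of _ "pos_powr q"])
        (auto simp: pos_powr_def eventually_nhds intro!: exI[of _ "{..<0}"])
  next
    case 3
    \<comment> \<open>At the corner the difference quotient is at most the power q - 1 of the step,
      which tends to 0 because q > 1.\<close>
    have "((\<lambda>h. pos_powr q h / h) \<longlongrightarrow> 0) (at 0)"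
    proof (rule Lim_null_comparison)
      show "\<forall>\<^sub>F h in at 0. norm (pos_powr q h / h) \<le> \<bar>h\<bar> powr (q - 1)"
      proof (intro always_eventually allI)
        fix h :: real
        show "norm (pos_powr q h / h) \<le> \<bar>h\<bar> powr (q - 1)"
        proof (cases "h > 0")
          case True
          then show ?thesis by (simp add: pos_powr_def powr_diff max_def)
        qed (simp add: pos_powr_def max_def)
      qed
      have "((\<lambda>h. \<bar>h\<bar> powr (q - 1)) \<longlongrightarrow> \<bar>0\<bar> powr (q - 1)) (at (0::real))"
        using assms by (intro tendsto_powr' tendsto_intros) auto
      then show "((\<lambda>h. \<bar>h\<bar> powr (q - 1)) \<longlongrightarrow> 0) (at (0::real))" by simp
    qed
    then show ?thesis
      unfolding 3 DERIV_def using assms by (simp add: pos_powr_def)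
  qed
qed

lemma continuous_on_pos_powr:
  assumes "0 < q" "continuous_on S f"
  shows "continuous_on S (\<lambda>x. pos_powr q (f x))"
  unfolding pos_powr_def
  by (rule continuous_on_powr'[OF continuous_on_max[OF assms(2) continuous_on_const] continuous_on_const])
    (use assms in auto)

text \<open>\<open>Phi\<close> equals \<open>s\<^sup>2 / 2\<close> on \<open>[-M, M]\<close>, so that its derivative at a value \<open>y\<close> of the profile is
  \<open>y\<close> itself, and it grows like \<open>\<bar>s\<bar> powr p\<close> at infinity.\<close>

definition Phi :: "real \<Rightarrow> real \<Rightarrow> real \<Rightarrow> real" where
  "Phi p M s = s\<^sup>2 / 2 - (pos_powr 2 (s - M) + pos_powr 2 (- s - M)) / 2 + (pos_powr p (s - M) + pos_powr p (- s - M))"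

text \<open>For s beyond M \<ge> 0 the first two terms combine to M, so the derivative is M plus p
  times a power p - 1 of the overshoot, and symmetrically below -M. It is increasing, so
  \<open>Phi\<close> is convex.\<close>

definition Phi' :: "real \<Rightarrow> real \<Rightarrow> real \<Rightarrow> real" where
  "Phi' p M s = s - (pos_powr 1 (s - M) - pos_powr 1 (- s - M)) + p * (pos_powr (p - 1) (s - M) - pos_powr (p - 1) (- s - M))"

lemma has_real_derivative_Phi:
  assumes "1 < p"
  shows "(Phi p M has_real_derivative Phi' p M s) (at s)"
proof -
  have d: "((\<lambda>s. pos_powr q (s - M)) has_real_derivative q * pos_powr (q - 1) (s - M)) (at s)"
    "((\<lambda>s. pos_powr q (- s - M)) has_real_derivative - (q * pos_powr (q - 1) (- s - M))) (at s)" if "1 < q" for q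
  proof -
    have "((\<lambda>s. s - M) has_real_derivative 1) (at s)" by (auto intro!: derivative_eq_intros)
    from DERIV_chain2[OF has_real_derivative_pos_powr[OF that] this]
    show "((\<lambda>s. pos_powr q (s - M)) has_real_derivative q * pos_powr (q - 1) (s - M)) (at s)"
      by simp
    have "((\<lambda>s. - s - M) has_real_derivative - 1) (at s)" by (auto intro!: derivative_eq_intros)
    from DERIV_chain2[OF has_real_derivative_pos_powr[OF that] this]
    show "((\<lambda>s. pos_powr q (- s - M)) has_real_derivative - (q * pos_powr (q - 1) (- s - M))) (at s)"
      by simp
  qed
  have sq: "((\<lambda>s. s\<^sup>2 / 2) has_real_derivative s) (at s)" by (auto intro!: derivative_eq_intros)
  have sum: "((\<lambda>s. pos_powr q (s - M) + pos_powr q (- s - M)) has_real_derivative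
      q * pos_powr (q - 1) (s - M) + - (q * pos_powr (q - 1) (- s - M))) (at s)" if "1 < q" for q
    using d[OF that] by (rule DERIV_add)
  have "(Phi p M has_real_derivative s
      - (2 * pos_powr (2 - 1) (s - M) + - (2 * pos_powr (2 - 1) (- s - M))) / 2
      + (p * pos_powr (p - 1) (s - M) + - (p * pos_powr (p - 1) (- s - M)))) (at s)"
    unfolding Phi_def[abs_def]
    by (rule DERIV_add[OF DERIV_diff[OF sq DERIV_cdivide[OF sum]] sum]) (use assms in auto)
  then show ?thesis
    by (rule DERIV_cong) (simp add: Phi'_def right_diff_distrib diff_divide_distrib)
qed

lemma continuous_on_Phi:
  assumes "1 < p" "continuous_on S f"
  shows "continuous_on S (\<lambda>x. Phi p M (f x))"
  unfolding Phi_def using assms by (intro continuous_intros continuous_on_pos_powr) auto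

lemma continuous_on_Phi':
  assumes "1 < p" "continuous_on S f"
  shows "continuous_on S (\<lambda>x. Phi' p M (f x))"
  unfolding Phi'_def using assms by (intro continuous_intros continuous_on_pos_powr) auto

section \<open>Pointwise comparison of the Bregman divergence with the p-th power of the
  distance\<close>

definition excess :: "real \<Rightarrow> real \<Rightarrow> real" where
  "excess M s = max (\<bar>s\<bar> - M) 0"

definition breg :: "real \<Rightarrow> real \<Rightarrow> real \<Rightarrow> real \<Rightarrow> real" where
  "breg p M s y = Phi p M s - y * s + y\<^sup>2 / 2"

text \<open>Both comparisons start from this form: the quadratic part is nonnegative since the
  excess is at most the distance of \<open>s\<close> from \<open>y\<close>, and the power takes over
  for large \<open>s\<close>.\<close>

lemma breg_eq:
  assumes "0 \<le> M" "1 < p"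
  shows "breg p M s y = ((s - y)\<^sup>2 - (excess M s)\<^sup>2) / 2 + excess M s powr p"
proof -
  have g: "pos_powr q (s - M) + pos_powr q (- s - M) = excess M s powr q" if "q > 0" for q
    using assms that by (cases "s \<ge> 0") (auto simp: pos_powr_def excess_def max_def)
  have "excess M s powr 2 = (excess M s)\<^sup>2"
    by (cases "excess M s = 0") (auto simp: excess_def)
  then show ?thesis
    using assms unfolding breg_def Phi_def by (simp add: g power2_eq_square algebra_simps diff_divide_distrib add_divide_distrib)
qed

text \<open>The excess is the distance from \<open>s\<close> to the interval [-M, M]. It is at most
  the distance to the point \<open>y\<close> of that interval, and differs from it by at most the
  length of the interval.\<close>

lemma excess_bounds:
  assumes "\<bar>y\<bar> \<le> M"
  shows "0 \<le> excess M s" "excess M s \<le> \<bar>s - y\<bar>" "\<bar>s - y\<bar> - excess M s \<le> 2 * M"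
  using assms by (auto simp: excess_def max_def)

text \<open>Near \<open>y\<close> the divergence can be quadratic, which for p > 2 no multiple of
  the p-th power dominates; the range of distances up to \<open>sqrt \<eta>\<close> is absorbed by
  \<eta>. Beyond it the quadratic part is at most 2 M d, and d is at most
  \<open>sqrt \<eta> powr (1 - p)\<close> times its own p-th power.\<close>

lemma breg_upper:
  assumes "1 < p" "0 \<le> M" "0 < \<eta>"
  obtains C where "0 < C" "\<And>s y. \<bar>y\<bar> \<le> M \<Longrightarrow> breg p M s y \<le> \<eta> + C * \<bar>s - y\<bar> powr p"
proof
  let ?C = "2 * M * sqrt \<eta> powr (1 - p) + 1"
  show "0 < ?C" using assms by (intro add_nonneg_pos mult_nonneg_nonneg) auto
  fix s y :: real assume y: "\<bar>y\<bar> \<le> M"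
  define d where "d = \<bar>s - y\<bar>"
  define w where "w = excess M s"
  have w: "0 \<le> w" "w \<le> d" "d - w \<le> 2 * M" using excess_bounds[OF y, of s] by (auto simp: d_def w_def)
  have "breg p M s y = (d - w) * (d + w) / 2 + w powr p"
    unfolding breg_eq[OF assms(2,1)] w_def[symmetric] by (simp add: d_def power2_eq_square algebra_simps)
  also have "\<dots> \<le> (d - w) * (d + d) / 2 + d powr p"
    using w assms by (intro add_mono divide_right_mono mult_left_mono powr_mono2) auto
  also have "\<dots> = (d - w) * d + d powr p" by simp
  also have "(d - w) * d \<le> \<eta> + 2 * M * sqrt \<eta> powr (1 - p) * d powr p"
  proof (cases "d \<le> sqrt \<eta>")
    case True
    have "(d - w) * d \<le> sqrt \<eta> * sqrt \<eta>"
      using True w assms by (intro mult_mono) auto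
    moreover have "0 \<le> 2 * M * sqrt \<eta> powr (1 - p) * d powr p"
      using assms by auto
    ultimately show ?thesis
      using real_sqrt_pow2[of \<eta>] assms(3) unfolding power2_eq_square by linarith
  next
    case False
    then have d: "0 < sqrt \<eta>" "sqrt \<eta> \<le> d" using assms by auto
    have "d = d powr (1 - p) * d powr p"
      using less_le_trans[OF d] by (simp add: powr_add[symmetric])
    also have "\<dots> \<le> sqrt \<eta> powr (1 - p) * d powr p"
      using d assms by (intro mult_right_mono powr_mono2') auto
    finally have "2 * M * d \<le> 2 * M * (sqrt \<eta> powr (1 - p) * d powr p)"
      using assms by (intro mult_left_mono) auto
    moreover have "(d - w) * d \<le> 2 * M * d" using w d by (intro mult_right_mono) auto
    ultimately show ?thesis using assms by (simp add: mult.assoc)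
  qed
  finally show "breg p M s y \<le> \<eta> + ?C * \<bar>s - y\<bar> powr p"
    by (simp add: d_def algebra_simps)
qed

text \<open>The distance d is split into d - w and the excess w. The p-th power of w is directly
  below the divergence, and so is half the square of d - w; as d - w stays below 2 M, its p-th power
  is controlled by its square away from 0 and absorbed by \<eta> near 0.\<close>

lemma breg_lower:
  assumes "1 < p" "0 \<le> M" "0 < \<eta>"
  obtains C where "0 < C" "\<And>s y. \<bar>y\<bar> \<le> M \<Longrightarrow> \<bar>s - y\<bar> powr p \<le> \<eta> + C * breg p M s y"
proof
  \<comment> \<open>The factor \<open>2 powr p\<close> is what splitting the p-th power of a sum
    costs later; dividing by it makes the error exactly \<eta>.\<close>
  define r where "r = (\<eta> / 2 powr p) powr (1 / p)"
  have r: "0 < r" "r powr p = \<eta> / 2 powr p"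
    using assms by (auto simp: r_def powr_powr)
  \<comment> \<open>The ratio between the largest p-th power of d - w and the smallest value of half
    its square, given that d - w exceeds \<open>r\<close>.\<close>
  let ?K = "2 * (2 * M) powr p / r\<^sup>2"
  let ?C = "2 powr p * (?K + 1)"
  have K: "0 \<le> ?K" using r by simp
  then show "0 < ?C" by (intro mult_pos_pos add_nonneg_pos) auto
  fix s y :: real assume y: "\<bar>y\<bar> \<le> M"
  define d where "d = \<bar>s - y\<bar>"
  define w where "w = excess M s"
  have w: "0 \<le> w" "w \<le> d" "d - w \<le> 2 * M" using excess_bounds[OF y, of s] by (auto simp: d_def w_def)
  have B: "breg p M s y = (d - w) * (d + w) / 2 + w powr p"
    unfolding breg_eq[OF assms(2,1)] w_def[symmetric] by (simp add: d_def power2_eq_square algebra_simps)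
  have "(d - w) * (d - w) / 2 \<le> (d - w) * (d + w) / 2"
    using w by (intro divide_right_mono mult_left_mono) auto
  then have B1: "(d - w)\<^sup>2 / 2 \<le> breg p M s y" and B2: "w powr p \<le> breg p M s y"
    using w unfolding B by (auto simp: power2_eq_square intro: order_trans)
  have B0: "0 \<le> breg p M s y" using B2 by (rule order_trans[rotated]) simp
  have e: "(d - w) powr p \<le> \<eta> / 2 powr p + ?K * breg p M s y"
  proof (cases "d - w \<le> r")
    case True
    then have "(d - w) powr p \<le> r powr p" using w assms by (intro powr_mono2) auto
    then show ?thesis using r K B0 by (simp add: add_increasing2)
  next
    case False
    have "(d - w) powr p \<le> (2 * M) powr p" using w assms by (intro powr_mono2) auto
    also have "\<dots> = ?K * (r\<^sup>2 / 2)" using r by simp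
    also have "\<dots> \<le> ?K * ((d - w)\<^sup>2 / 2)"
      using False r K by (intro mult_left_mono divide_right_mono power_mono) auto
    also have "\<dots> \<le> ?K * breg p M s y" using K B1 by (intro mult_left_mono)
    finally show ?thesis using assms by (simp add: add_increasing)
  qed
  have "d powr p \<le> (2 * max (d - w) w) powr p"
    using w assms by (intro powr_mono2) (auto simp: max_def)
  also have "\<dots> = 2 powr p * max (d - w) w powr p" using w by (simp add: powr_mult)
  also have "\<dots> \<le> 2 powr p * ((d - w) powr p + w powr p)"
    by (intro mult_left_mono) (auto simp: max_def)
  also have "\<dots> \<le> 2 powr p * (\<eta> / 2 powr p + ?K * breg p M s y + breg p M s y)"
    using e B2 by (intro mult_left_mono add_mono) auto
  also have "\<dots> = \<eta> + ?C * breg p M s y"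
  proof -
    have h: "2 powr p * (\<eta> / 2 powr p) = \<eta>" by simp
    show ?thesis unfolding distrib_left distrib_right h by (simp add: mult.assoc)
  qed
  finally show "\<bar>s - y\<bar> powr p \<le> \<eta> + ?C * breg p M s y" by (simp add: d_def)
qed


section \<open>Regularity of smooth solutions\<close>

text \<open>The smooth extension \<open>F\<close> agrees with \<zeta> only at nonnegative times. The
  two-sided \<open>deriv\<close> in time is therefore identified only for t > 0, where agreement
  holds on an open set of times; time zero is covered by continuity.\<close>

lemma smooth_on_time_space:
  fixes \<zeta> :: "real \<Rightarrow> real^3 \<Rightarrow> real"
  assumes "smooth_on (\<lambda>(t, x). \<zeta> t x) ({0..} \<times> S2)"
  shows smooth_time_space_continuous: "continuous_on ({0..} \<times> S2) (\<lambda>(t, x). \<zeta> t x)"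
    and smooth_time_deriv: "\<And>t x. 0 < t \<Longrightarrow> x \<in> S2 \<Longrightarrow> ((\<lambda>s. \<zeta> s x) has_real_derivative deriv (\<lambda>s. \<zeta> s x) t) (at t)"
    and smooth_time_deriv_continuous: "continuous_on ({0<..} \<times> S2) (\<lambda>(t, x). deriv (\<lambda>s. \<zeta> s x) t)"
    and smooth_slice: "\<And>t. 0 \<le> t \<Longrightarrow> smooth0 (\<lambda>y. \<zeta> t (sgn y))"
proof -
  obtain U F where U: "open U" "{0..} \<times> S2 \<subseteq> U" and F: "\<And>k. Ck_on k F U"
    and eq: "\<And>t x. 0 \<le> t \<Longrightarrow> x \<in> S2 \<Longrightarrow> F (t, x) = \<zeta> t x"
    using assms unfolding smooth_on_def by force
  have Fd: "(F has_derivative frechet_derivative F (at z)) (at z)" if "z \<in> U" for z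
    by (rule Ck_on_has_derivative[OF F that])
  have "continuous_on U F" using F[of 0] by simp
  then have "continuous_on ({0..} \<times> S2) F" by (rule continuous_on_subset[OF _ U(2)])
  then show "continuous_on ({0..} \<times> S2) (\<lambda>(t, x). \<zeta> t x)"
    by (rule continuous_on_eq) (auto simp: eq)
  have D: "((\<lambda>s. \<zeta> s x) has_real_derivative frechet_derivative F (at (t, x)) (1, 0)) (at t)"
    if "0 < t" "x \<in> S2" for t x
  proof -
    have z: "(t, x) \<in> U" using that U(2) by auto
    have "((\<lambda>s. (s, x)) has_derivative (\<lambda>h. (h, 0))) (at t)" by (auto intro!: derivative_eq_intros)
    from has_derivative_compose[OF this Fd[OF z]]
    have d: "((\<lambda>s. F (s, x)) has_derivative (\<lambda>h. frechet_derivative F (at (t, x)) (h, 0))) (at t)" .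
    have l: "frechet_derivative F (at (t, x)) (h, 0) = frechet_derivative F (at (t, x)) (1, 0) * h" for h
      using linear_cmul[OF has_derivative_linear[OF Fd[OF z]], of h "(1, 0)"] by (simp add: mult.commute)
    have "((\<lambda>s. F (s, x)) has_real_derivative frechet_derivative F (at (t, x)) (1, 0)) (at t)"
      unfolding has_field_derivative_def by (rule has_derivative_eq_rhs[OF d]) (rule ext, rule l)
    then show ?thesis
      using that by (subst (asm) DERIV_cong_ev[OF refl _ refl, of _ "\<lambda>s. \<zeta> s x"])
        (auto simp: eventually_nhds eq intro!: exI[of _ "{0<..}"])
  qed
  then show "((\<lambda>s. \<zeta> s x) has_real_derivative deriv (\<lambda>s. \<zeta> s x) t) (at t)" if "0 < t" "x \<in> S2" for t x
    using that DERIV_imp_deriv by metis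
  have "(1, 0) \<in> (Basis :: (real \<times> (real^3)) set)" by (simp add: Basis_prod_def)
  then have "continuous_on U (\<lambda>z. frechet_derivative F (at z) (1, 0))" using F[of "Suc 0"] by simp
  then have "continuous_on ({0<..} \<times> S2) (\<lambda>z. frechet_derivative F (at z) (1, 0))"
    by (rule continuous_on_subset) (use U(2) in auto)
  then show "continuous_on ({0<..} \<times> S2) (\<lambda>(t, x). deriv (\<lambda>s. \<zeta> s x) t)"
    by (rule continuous_on_eq) (auto simp: DERIV_imp_deriv[OF D])
  fix t :: real assume t: "0 \<le> t"
  have "(t, sgn y) \<in> U" if "y \<noteq> 0" for y :: "real^3"
    using U(2) norm_sgn[of y] that t by auto
  moreover have "Ck_on k (\<lambda>y::real^3. (t, sgn y) \<bullet> c) (- {0})" for k and c :: "real \<times> (real^3)"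
  proof (cases c)
    case (Pair c1 c2)
    then show ?thesis by (simp add: open_Compl Ck_on_add Ck_on_const Ck_on_sgn)
  qed
  ultimately have "smooth0 (\<lambda>y. F (t, sgn y))"
    unfolding smooth0_def by (auto intro!: Ck_on_compose[OF _ _ F])
  then show "smooth0 (\<lambda>y. \<zeta> t (sgn y))"
    by (rule smooth0_cong[rotated]) (use t in \<open>auto simp: eq norm_sgn\<close>)
qed

lemma smooth_slice_continuous:
  fixes \<zeta> :: "real \<Rightarrow> real^3 \<Rightarrow> real"
  assumes "smooth_on (\<lambda>(t, x). \<zeta> t x) ({0..} \<times> S2)" "0 \<le> t"
  shows "continuous_on S2 (\<zeta> t)"
  by (rule continuous_on_eq[OF smooth0_continuous_S2[OF smooth_slice[OF assms]]]) (simp add: sgn_div_norm)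

section \<open>Rotating degree-one profiles\<close>

lemma rot3_eq:
  "rot3 \<beta> x = (cos \<beta> * x $ 1 - sin \<beta> * x $ 2) *\<^sub>R axis 1 1 + (sin \<beta> * x $ 1 + cos \<beta> * x $ 2) *\<^sub>R axis 2 1 + x $ 3 *\<^sub>R axis 3 1"
  by (simp add: rot3_def vector_3_eq_axis)

lemma norm_rot3: "norm (rot3 \<beta> x) = norm x"
proof -
  have "rot3 \<beta> x \<bullet> rot3 \<beta> x = x \<bullet> x"
    unfolding rot3_def inner_vec_def sum_3 vector_3 inner_real_def
    using sin_cos_squared_add[of \<beta>] by algebra
  then show ?thesis by (simp add: norm_eq_sqrt_inner)
qed

lemma rot3_0: "rot3 0 x = x"
  by (simp add: rot3_def vec_eq_iff forall_3)

lemma inner_rot3: "a \<bullet> rot3 \<beta> x = rot3 (- \<beta>) a \<bullet> x"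
  by (simp add: rot3_def inner_vec_def sum_3 algebra_simps)

text \<open>By \<open>inner_rot3\<close> this differentiates the moving profile
  \<open>a \<bullet> rot3 (\<beta> + \<omega> * t) x\<close>; turning \<open>a\<close> instead of
  \<open>x\<close> keeps it visibly linear in \<open>x\<close>.\<close>

lemma has_real_derivative_rot3:
  "((\<lambda>t. rot3 (- (\<beta> + \<omega> * t)) a \<bullet> x) has_real_derivative
     \<omega> * (rot3 (- (\<beta> + \<omega> * t)) a \<bullet> cross3 (axis 3 1) x)) (at t)"
proof -
  have eq: "rot3 (- (\<beta> + \<omega> * t)) a \<bullet> x = (cos (\<beta> + \<omega> * t) * a $ 1 + sin (\<beta> + \<omega> * t) * a $ 2) * x $ 1
      + (cos (\<beta> + \<omega> * t) * a $ 2 - sin (\<beta> + \<omega> * t) * a $ 1) * x $ 2 + a $ 3 * x $ 3" for t x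
    unfolding rot3_def inner_vec_def sum_3 vector_3 inner_real_def cos_minus sin_minus by algebra
  show ?thesis
    unfolding eq
    by (auto intro!: derivative_eq_intros simp: cross3_def axis_def algebra_simps)
qed

lemma continuous_on_rot3_inner:
  fixes f :: "'a::t2_space \<Rightarrow> real"
  assumes "continuous_on S f" "continuous_on S g"
  shows "continuous_on S (\<lambda>z. rot3 (f z) a \<bullet> g z)"
  unfolding rot3_eq by (intro continuous_intros assms)


section \<open>Conservation of the Bregman functional\<close>

text \<open>At \<open>z = \<zeta> t\<close> this is the time derivative of \<open>sint (\<lambda>x. breg p M (\<zeta> t x) (b \<bullet> x))\<close>, where \<open>b\<close> moves
  with \<open>b' \<bullet> x = \<omega> * (b \<bullet> cross3 (axis 3 1) x)\<close>.\<close>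

lemma sint_breg_time_derivative:
  assumes p: "1 < p" and z: "smooth0 (\<lambda>y. z (sgn y))"
    and \<psi>: "smooth_on \<psi> S2" "is_G 2 z \<psi>"
    and eq: "\<And>x. x \<in> S2 \<Longrightarrow> z' x + Jrot x (sgrad (\<lambda>y. \<omega> * y $ 3 - \<psi> y) x) \<bullet> sgrad z x = 0"
  shows "sint (\<lambda>x. (Phi' p M (z x) - b \<bullet> x) * z' x
      + (b \<bullet> x - z x) * (\<omega> * (b \<bullet> cross3 (axis 3 1) x))) = 0"
proof -
  define e3 :: "real^3" where "e3 = axis 3 1"
  define Z where "Z y = z (sgn y)" for y
  define h where "h y = \<omega> * sgn y $ 3 - \<psi> (sgn y)" for y :: "real^3"
  have Z: "smooth0 Z" using z by (simp add: Z_def[abs_def])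
  have p\<psi>: "smooth0 (\<lambda>y. \<psi> (sgn y))" by (rule smooth_on_S2_imp_smooth0[OF \<psi>(1)])
  have inv: "smooth0 (\<lambda>y::real^3. inverse (norm y) ^ 1)"
    unfolding smooth0_def using Ck_on_inverse_norm_power by blast
  define s3 where "s3 y = (y \<bullet> e3) * inverse (norm y) ^ 1" for y :: "real^3"
  have s3: "smooth0 s3"
    unfolding s3_def[abs_def] by (rule smooth0_mult[OF smooth0_inner_const inv])
  have h_eq: "h = (\<lambda>y. \<omega> * s3 y - \<psi> (sgn y))"
    by (simp add: fun_eq_iff h_def s3_def e3_def inner_axis sgn_div_norm divide_inverse mult.commute)
  have h: "smooth0 h"
    unfolding h_eq by (intro smooth0_diff smooth0_mult smooth0_const s3 p\<psi>)
  have x0: "x \<noteq> 0" if "x \<in> S2" for x :: "real^3" using that by auto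
  have Zz: "Z x = z x" if "x \<in> S2" for x using that by (simp add: Z_def sgn_div_norm)
  have cz: "continuous_on S2 z"
    by (rule continuous_on_eq[OF smooth0_continuous_S2[OF Z] Zz])
  have cZ: "continuous_on S2 Z" by (rule smooth0_continuous_S2[OF Z])
  note dZ = smooth0_differentiable[OF Z x0] and dh = smooth0_differentiable[OF h x0]
  note gZ = smooth0_grad_continuous_S2[OF Z] and gh = smooth0_grad_continuous_S2[OF h]
  let ?T = "\<lambda>x. x \<bullet> cross3 (grad Z x) (grad h x)"
  have z': "z' x = ?T x" if x: "x \<in> S2" for x
  proof -
    have "sgrad z x = grad Z x" by (simp add: sgrad_eq_grad Z_def[abs_def])
    moreover have "sgrad (\<lambda>y. \<omega> * y $ 3 - \<psi> y) x = grad h x"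
      by (simp add: sgrad_eq_grad h_def[abs_def])
    ultimately have "z' x = - (cross3 x (grad h x) \<bullet> grad Z x)"
      using eq[OF x] by (simp add: Jrot_def)
    also have "\<dots> = ?T x" by (simp add: cross3_simps)
    finally show ?thesis .
  qed
  have cT: "continuous_on S2 ?T"
    by (intro continuous_intros continuous_on_cross gZ gh)
  have cPhi: "continuous_on S2 (\<lambda>x. Phi' p M (Z x))"
    by (rule continuous_on_Phi'[OF p cZ])

  \<comment> \<open>Casimir part: \<open>Phi'\<close> times the transport term is the transport term
    of \<open>Phi p M (Z y)\<close>.\<close>
  have I1: "sint (\<lambda>x. Phi' p M (Z x) * ?T x) = 0"
  proof -
    have "((\<lambda>y. Phi p M (Z y)) has_derivative (\<lambda>v. (Phi' p M (Z x) *\<^sub>R grad Z x) \<bullet> v)) (at x)" if "x \<in> S2" for x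
      using has_derivative_compose[OF grad_works[OF dZ[OF that]]
          has_real_derivative_Phi[OF p, unfolded has_field_derivative_def]]
      by simp
    then have g: "grad (\<lambda>y. Phi p M (Z y)) x = Phi' p M (Z x) *\<^sub>R grad Z x"
      and d: "(\<lambda>y. Phi p M (Z y)) differentiable at x" if "x \<in> S2" for x
      using that grad_eqI differentiableI by blast+
    have "continuous_on S2 (\<lambda>x. Phi' p M (Z x) *\<^sub>R grad Z x)"
      by (intro continuous_intros cPhi gZ)
    then have "continuous_on S2 (grad (\<lambda>y. Phi p M (Z y)))"
      by (rule continuous_on_eq) (simp add: g)
    from sint_triple_product[OF h d this]
    have "sint (\<lambda>x. x \<bullet> cross3 (grad (\<lambda>y. Phi p M (Z y)) x) (grad h x)) = 0" .
    then show ?thesis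
      using sint_cong[of "\<lambda>x. x \<bullet> cross3 (grad (\<lambda>y. Phi p M (Z y)) x) (grad h x)" "\<lambda>x. Phi' p M (Z x) * ?T x"]
      by (simp add: g cross_mult_left)
  qed

  \<comment> \<open>The gradient of \<open>s3\<close> is the tangential part of \<open>e3\<close>;
    its radial correction drops out of the cross product with \<open>x\<close>.\<close>
  have rb: "rotd b h x = - (\<omega> * (b \<bullet> cross3 e3 x)) - rotd b (\<lambda>y. \<psi> (sgn y)) x" if x: "x \<in> S2" for x
  proof -
    have n: "norm x = 1" using x by simp
    have d: "((\<lambda>y. inverse (norm y) ^ 1) has_derivative (\<lambda>h. (- x) \<bullet> h)) (at x)"
      using has_derivative_inverse_norm_power[OF x0[OF x], of 1] n by (simp add: inner_commute)
    have "grad s3 x = (x \<bullet> e3) *\<^sub>R grad (\<lambda>y. inverse (norm y) ^ 1) x + (inverse (norm x) ^ 1) *\<^sub>R grad (\<lambda>y. y \<bullet> e3) x"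
      unfolding s3_def[abs_def]
      by (rule grad_mult[OF bounded_linear_imp_differentiable[OF bounded_linear_inner_left] differentiableI[OF d]])
    then have "grad s3 x = e3 - (x \<bullet> e3) *\<^sub>R x"
      unfolding grad_eqI[OF d] grad_inner_const using n by simp
    moreover have "grad h x = \<omega> *\<^sub>R grad s3 x - grad (\<lambda>y. \<psi> (sgn y)) x"
      unfolding h_eq
      by (subst grad_diff)
        (auto simp: grad_mult grad_const smooth0_differentiable[OF s3 x0[OF x]]
          intro!: differentiable_mult smooth0_differentiable[OF s3 x0[OF x]] smooth0_differentiable[OF p\<psi> x0[OF x]])
    ultimately have gh: "grad h x = \<omega> *\<^sub>R (e3 - (x \<bullet> e3) *\<^sub>R x) - grad (\<lambda>y. \<psi> (sgn y)) x" by simp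
    show ?thesis
      unfolding rotd_triple gh by (simp add: cross3_simps)
  qed

  \<comment> \<open>First moments: expanding the transport term of the product \<open>?g\<close>
    leaves \<open>rotd b h\<close> against the vorticity. The planetary part of \<open>h\<close>
    gives the rotation, and the stream function contributes nothing.\<close>
  have I2: "sint (\<lambda>x. (b \<bullet> x) * ?T x) = - sint (\<lambda>x. z x * (\<omega> * (b \<bullet> cross3 e3 x)))"
  proof -
    let ?g = "\<lambda>y. (y \<bullet> b) * Z y"
    have sg: "smooth0 ?g" by (rule smooth0_mult[OF smooth0_inner_const Z])
    have g: "grad ?g x = (x \<bullet> b) *\<^sub>R grad Z x + Z x *\<^sub>R b" if "x \<in> S2" for x
      by (simp add: grad_mult[OF smooth0_differentiable[OF smooth0_inner_const x0[OF that]] dZ[OF that]] grad_inner_const)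
    have "0 = sint (\<lambda>x. x \<bullet> cross3 (grad ?g x) (grad h x))"
      by (rule sint_triple_product[OF h smooth0_differentiable[OF sg x0] smooth0_grad_continuous_S2[OF sg], symmetric])
    also have "\<dots> = sint (\<lambda>x. (b \<bullet> x) * ?T x + (z x * (\<omega> * (b \<bullet> cross3 e3 x)) + z x * rotd b (\<lambda>y. \<psi> (sgn y)) x))"
    proof (rule sint_cong)
      fix x :: "real^3" assume x: "x \<in> S2"
      have "x \<bullet> cross3 (grad ?g x) (grad h x) = (b \<bullet> x) * ?T x + Z x * (x \<bullet> cross3 b (grad h x))"
        by (simp add: g[OF x] cross_add_left cross_mult_left inner_add_right inner_commute)
      moreover have "x \<bullet> cross3 b (grad h x) = - rotd b h x"
        by (simp add: rotd_triple cross3_simps)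
      ultimately show "x \<bullet> cross3 (grad ?g x) (grad h x) =
          (b \<bullet> x) * ?T x + (z x * (\<omega> * (b \<bullet> cross3 e3 x)) + z x * rotd b (\<lambda>y. \<psi> (sgn y)) x)"
        unfolding rb[OF x] Zz[OF x] by (simp add: algebra_simps)
    qed
    also have "\<dots> = sint (\<lambda>x. (b \<bullet> x) * ?T x) + (sint (\<lambda>x. z x * (\<omega> * (b \<bullet> cross3 e3 x)))
        + sint (\<lambda>x. z x * rotd b (\<lambda>y. \<psi> (sgn y)) x))"
      by (subst sint_add, (intro continuous_intros continuous_on_cross cT cz smooth0_continuous_S2 smooth0_rotd p\<psi>)+,
          subst sint_add, (intro continuous_intros continuous_on_cross cT cz smooth0_continuous_S2 smooth0_rotd p\<psi>)+, rule refl)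
    also have "sint (\<lambda>x. z x * rotd b (\<lambda>y. \<psi> (sgn y)) x) = 0"
      by (rule sint_mult_rotd_stream_function[OF \<psi> cz])
    finally show ?thesis by simp
  qed

  \<comment> \<open>Half of \<omega> times the derivative of a square along the third axis rotation,
    hence of zero integral.\<close>
  have I3: "sint (\<lambda>x. (b \<bullet> x) * (\<omega> * (b \<bullet> cross3 e3 x))) = 0"
  proof -
    have "0 = \<omega> / 2 * sint (rotd e3 (\<lambda>x. (x \<bullet> b) * (x \<bullet> b)))"
      by (simp add: sint_rotd_smooth0 smooth0_mult smooth0_inner_const)
    also have "\<dots> = sint (\<lambda>x. \<omega> / 2 * rotd e3 (\<lambda>x. (x \<bullet> b) * (x \<bullet> b)) x)"
      by (simp only: sint_cmult)
    also have "\<dots> = sint (\<lambda>x. (b \<bullet> x) * (\<omega> * (b \<bullet> cross3 e3 x)))"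
    proof (rule sint_cong)
      fix x :: "real^3" assume "x \<in> S2"
      have d: "(\<lambda>x. x \<bullet> b) differentiable at x"
        by (rule bounded_linear_imp_differentiable[OF bounded_linear_inner_left])
      show "\<omega> / 2 * rotd e3 (\<lambda>x. (x \<bullet> b) * (x \<bullet> b)) x = (b \<bullet> x) * (\<omega> * (b \<bullet> cross3 e3 x))"
        by (simp add: rotd_mult[OF d d]) (simp add: rotd_def grad_inner_const inner_commute[of x])
    qed
    finally show ?thesis by simp
  qed

  have "sint (\<lambda>x. (Phi' p M (z x) - b \<bullet> x) * z' x + (b \<bullet> x - z x) * (\<omega> * (b \<bullet> cross3 e3 x)))
    = sint (\<lambda>x. (Phi' p M (Z x) * ?T x - (b \<bullet> x) * ?T x)
        + ((b \<bullet> x) * (\<omega> * (b \<bullet> cross3 e3 x)) - z x * (\<omega> * (b \<bullet> cross3 e3 x))))"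
    by (rule sint_cong) (simp add: z' Zz left_diff_distrib)
  also have "\<dots> = (sint (\<lambda>x. Phi' p M (Z x) * ?T x) - sint (\<lambda>x. (b \<bullet> x) * ?T x))
      + (sint (\<lambda>x. (b \<bullet> x) * (\<omega> * (b \<bullet> cross3 e3 x))) - sint (\<lambda>x. z x * (\<omega> * (b \<bullet> cross3 e3 x))))"
  proof -
    have c: "continuous_on S2 (\<lambda>x. Phi' p M (Z x) * ?T x)" "continuous_on S2 (\<lambda>x. (b \<bullet> x) * ?T x)"
      "continuous_on S2 (\<lambda>x. (b \<bullet> x) * (\<omega> * (b \<bullet> cross3 e3 x)))" "continuous_on S2 (\<lambda>x. z x * (\<omega> * (b \<bullet> cross3 e3 x)))"
      by (intro continuous_on_mult cPhi cT cz continuous_on_const continuous_on_inner continuous_on_cross continuous_on_id)+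
    show ?thesis
      unfolding sint_add[OF continuous_on_diff[OF c(1,2)] continuous_on_diff[OF c(3,4)]]
        sint_diff[OF c(1,2)] sint_diff[OF c(3,4)] ..
  qed
  also have "\<dots> = 0" unfolding I1 I2 I3 by simp
  finally show ?thesis unfolding e3_def .
qed

lemma continuous_on_breg:
  assumes "1 < p" "continuous_on S f" "continuous_on S g"
  shows "continuous_on S (\<lambda>x. breg p M (f x) (g x))"
  unfolding breg_def
  by (intro continuous_on_add continuous_on_diff continuous_on_mult continuous_on_divide
      continuous_on_power continuous_on_const continuous_on_Phi assms) simp

lemma sint_breg_conserved:
  assumes p: "1 < p" and sol: "smooth_solution \<omega> \<zeta>" and t: "0 < t"
  shows "sint (\<lambda>x. breg p M (\<zeta> t x) (a \<bullet> rot3 (\<beta> + \<omega> * t) x)) = sint (\<lambda>x. breg p M (\<zeta> 0 x) (a \<bullet> rot3 \<beta> x))"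
proof -
  define b where "b t = rot3 (- (\<beta> + \<omega> * t)) a" for t
  have sm: "smooth_on (\<lambda>(t, x). \<zeta> t x) ({0..} \<times> S2)" using sol by (simp add: smooth_solution_def)
  define f where "f t x = breg p M (\<zeta> t x) (b t \<bullet> x)" for t x
  define f' where "f' t x = (Phi' p M (\<zeta> t x) - b t \<bullet> x) * deriv (\<lambda>s. \<zeta> s x) t
      + (b t \<bullet> x - \<zeta> t x) * (\<omega> * (b t \<bullet> cross3 (axis 3 1) x))" for t x
  have sph: "(\<lambda>(t, z). (t, sph_coords z)) ` (A \<times> coord_box) \<subseteq> A \<times> S2" for A :: "real set"
    by auto
  have csph: "continuous_on (A \<times> coord_box) (\<lambda>(t, z). (t, sph_coords z))" for A :: "real set"
    unfolding case_prod_beta by (intro continuous_intros continuous_on_compose2[OF continuous_on_sph_coords[of UNIV]]) auto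
  have cz: "continuous_on ({0..} \<times> coord_box) (\<lambda>w. \<zeta> (fst w) (sph_coords (snd w)))"
    using continuous_on_compose2[OF smooth_time_space_continuous[OF sm] csph sph] by (simp add: case_prod_beta)
  have cz': "continuous_on ({0<..} \<times> coord_box) (\<lambda>w. deriv (\<lambda>s. \<zeta> s (sph_coords (snd w))) (fst w))"
    using continuous_on_compose2[OF smooth_time_deriv_continuous[OF sm] csph sph] by (simp add: case_prod_beta)
  have cs: "continuous_on A (\<lambda>w. sph_coords (snd w))" for A :: "(real \<times> real \<times> real) set"
    by (rule continuous_on_compose2[OF continuous_on_sph_coords[of UNIV]]) (auto intro!: continuous_intros)
  have cb: "continuous_on A (\<lambda>w. b (fst w) \<bullet> sph_coords (snd w))" for A :: "(real \<times> real \<times> real) set"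
    unfolding b_def by (intro continuous_on_rot3_inner cs continuous_intros)
  have cb': "continuous_on A (\<lambda>w. b (fst w) \<bullet> cross3 (axis 3 1) (sph_coords (snd w)))" for A :: "(real \<times> real \<times> real) set"
    unfolding b_def by (intro continuous_on_rot3_inner continuous_on_cross cs continuous_intros)
  have cc: "continuous_on A (\<lambda>w. cos (snd (snd w)))" for A :: "(real \<times> real \<times> real) set"
    by (intro continuous_intros)
  have cf: "continuous_on ({0..} \<times> coord_box) (\<lambda>(t, z). cos (snd z) * f t (sph_coords z))"
    unfolding case_prod_beta f_def by (rule continuous_on_mult[OF cc continuous_on_breg[OF p cz cb]])
  have cz2: "continuous_on ({0<..} \<times> coord_box) (\<lambda>w. \<zeta> (fst w) (sph_coords (snd w)))"
    by (rule continuous_on_subset[OF cz]) auto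
  have cf': "continuous_on ({0<..} \<times> coord_box) (\<lambda>(t, z). cos (snd z) * f' t (sph_coords z))"
    unfolding case_prod_beta f'_def
    by (rule continuous_on_mult[OF cc continuous_on_add[OF
          continuous_on_mult[OF continuous_on_diff[OF continuous_on_Phi'[OF p cz2] cb] cz']
          continuous_on_mult[OF continuous_on_diff[OF cb cz2] continuous_on_mult[OF continuous_on_const cb']]]])
  have der: "((\<lambda>t. f t x) has_real_derivative f' t x) (at t)" if "0 < t" "x \<in> S2" for t x
  proof -
    have dz: "((\<lambda>s. \<zeta> s x) has_real_derivative deriv (\<lambda>s. \<zeta> s x) t) (at t)"
      by (rule smooth_time_deriv[OF sm that])
    have db: "((\<lambda>t. b t \<bullet> x) has_real_derivative \<omega> * (b t \<bullet> cross3 (axis 3 1) x)) (at t)"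
      unfolding b_def by (rule has_real_derivative_rot3)
    show ?thesis
      unfolding f_def breg_def
      by (rule DERIV_cong[OF DERIV_add[OF DERIV_diff[OF DERIV_chain2[OF has_real_derivative_Phi[OF p] dz]
            DERIV_mult[OF db dz]] DERIV_cdivide[OF DERIV_power[OF db, of 2]]]])
        (simp add: f'_def algebra_simps)
  qed
  have E': "((\<lambda>t. sint (f t)) has_real_derivative 0) (at t)" if t: "0 < t" for t
  proof -
    \<comment> \<open>Leibniz's rule is used on the open half-line only, where the time derivative
      and the equation are available.\<close>
    have "((\<lambda>t. integral coord_box (\<lambda>z. cos (snd z) * f t (sph_coords z))) has_real_derivative
        integral coord_box (\<lambda>z. cos (snd z) * f' t (sph_coords z))) (at t within {0<..})"
    proof (rule leibniz_rule_field_derivative)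
      fix t :: real and z :: "real \<times> real" assume "t \<in> {0<..}"
      then show "((\<lambda>t. cos (snd z) * f t (sph_coords z)) has_real_derivative cos (snd z) * f' t (sph_coords z)) (at t within {0<..})"
        by (intro DERIV_cmult has_field_derivative_at_within[OF der]) auto
    next
      fix t :: real assume "t \<in> {0<..}"
      then show "(\<lambda>z. cos (snd z) * f t (sph_coords z)) integrable_on coord_box"
        by (intro integrable_continuous continuous_on_compose2[OF cf, of _ "\<lambda>z. (t, z)", unfolded case_prod_beta fst_conv snd_conv])
          (auto intro!: continuous_intros)
    qed (use t cf' in auto)
    then have "((\<lambda>t. sint (f t)) has_real_derivative sint (f' t)) (at t)"
      using t by (simp add: sint_def at_within_open[of t "{0<..}"])
    moreover obtain \<psi> where \<psi>: "smooth_on \<psi> S2" "\<forall>r>1. is_G r (\<zeta> t) \<psi>"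
      "\<forall>x\<in>S2. deriv (\<lambda>s. \<zeta> s x) t + Jrot x (sgrad (\<lambda>y. \<omega> * y $ 3 - \<psi> y) x) \<bullet> sgrad (\<zeta> t) x = 0"
      using sol t unfolding smooth_solution_def by blast
    have "sint (f' t) = 0"
      unfolding f'_def
      by (rule sint_breg_time_derivative[OF p smooth_slice[OF sm] \<psi>(1)]) (use t \<psi> in auto)
    ultimately show ?thesis by simp
  qed
  \<comment> \<open>Continuity up to time zero carries the constancy on positive times to the
    initial value.\<close>
  have "continuous_on {0..} (\<lambda>t. sint (f t))"
    unfolding sint_def by (rule integral_continuous_on_param[OF cf])
  then have "continuous_on {0..t} (\<lambda>t. sint (f t))"
    by (rule continuous_on_subset) auto
  then have "sint (f t) = sint (f 0)"
    using DERIV_isconst_end[OF t] E' by blast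
  then show ?thesis
    by (simp add: f_def[abs_def] b_def inner_rot3)
qed


section \<open>Stability\<close>

text \<open>The \<delta> obtained depends only on \<open>p\<close>, \<open>a\<close> and \<epsilon>,
  not on \<omega>, \<beta> or the time.\<close>

lemma moving_profile_stable:
  assumes p: "1 < p" and \<epsilon>: "0 < \<epsilon>"
  obtains \<delta> where "0 < \<delta>" "\<And>\<omega> \<zeta> \<beta> t. \<lbrakk>smooth_solution \<omega> \<zeta>; 0 < t; Lp_norm p (\<lambda>x. \<zeta> 0 x - a \<bullet> rot3 \<beta> x) < \<delta>\<rbrakk>
    \<Longrightarrow> Lp_norm p (\<lambda>x. \<zeta> t x - a \<bullet> rot3 (\<beta> + \<omega> * t) x) < \<epsilon>"
proof -
  define M where "M = norm a"
  have M: "0 \<le> M" by (simp add: M_def)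
  define S where "S = sint (\<lambda>x. 1)"
  have S: "0 \<le> S" unfolding S_def by (intro sint_nonneg) auto
  \<comment> \<open>\<open>S\<close> is the total area. This makes the integrated error
    \<open>S * \<eta>\<close> at most a quarter of \<open>\<epsilon> powr p\<close>; the error
    occurs twice, once for each comparison.\<close>
  define \<eta> where "\<eta> = \<epsilon> powr p / (4 * (S + 1))"
  have \<eta>: "0 < \<eta>" using \<epsilon> S by (simp add: \<eta>_def)
  obtain C where C: "0 < C" "\<And>s y. \<bar>y\<bar> \<le> M \<Longrightarrow> \<bar>s - y\<bar> powr p \<le> \<eta> + C * breg p M s y"
    using breg_lower[OF p M \<eta>] by blast
  \<comment> \<open>The upper comparison is later multiplied by \<open>C\<close>, so its own error
    is taken smaller by that factor.\<close>
  have \<eta>C: "0 < \<eta> / C" using \<eta> C by simp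
  obtain C' where C': "0 < C'" "\<And>s y. \<bar>y\<bar> \<le> M \<Longrightarrow> breg p M s y \<le> \<eta> / C + C' * \<bar>s - y\<bar> powr p"
    using breg_upper[OF p M \<eta>C] by blast
  \<comment> \<open>The initial distance enters the final bound with factor \<open>C * C'\<close>;
    this choice lets it use the remaining half of \<open>\<epsilon> powr p\<close>.\<close>
  define \<delta> where "\<delta> = (\<epsilon> powr p / (2 * C * C')) powr (1 / p)"
  have \<delta>: "0 < \<delta>" "C * C' * \<delta> powr p = \<epsilon> powr p / 2"
    using \<epsilon> C C' p by (auto simp: \<delta>_def powr_powr)
  have S\<eta>: "S * \<eta> \<le> \<epsilon> powr p / 4"
  proof -
    have "S * \<eta> \<le> (S + 1) * \<eta>" using \<eta> by simp
    also have "\<dots> = \<epsilon> powr p / 4" using S by (simp add: \<eta>_def field_simps)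
    finally show ?thesis .
  qed
  show thesis
  proof (rule that[OF \<delta>(1)])
    fix \<omega> \<zeta> \<beta> and t :: real
    assume sol: "smooth_solution \<omega> \<zeta>" and t: "0 < t"
      and d0: "Lp_norm p (\<lambda>x. \<zeta> 0 x - a \<bullet> rot3 \<beta> x) < \<delta>"
    have sm: "smooth_on (\<lambda>(t, x). \<zeta> t x) ({0..} \<times> S2)" using sol by (simp add: smooth_solution_def)
    have cz: "continuous_on S2 (\<zeta> s)" if "0 \<le> s" for s
      by (rule smooth_slice_continuous[OF sm that])
    have cy: "continuous_on S2 (\<lambda>x. a \<bullet> rot3 \<gamma> x)" for \<gamma>
      unfolding inner_rot3 by (intro continuous_intros)
    have y: "\<bar>a \<bullet> rot3 \<gamma> x\<bar> \<le> M" if "x \<in> S2" for \<gamma> x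
      using Cauchy_Schwarz_ineq2[of a "rot3 \<gamma> x"] that by (simp add: M_def norm_rot3)
    define N where "N s = sint (\<lambda>x. \<bar>\<zeta> s x - a \<bullet> rot3 (\<beta> + \<omega> * s) x\<bar> powr p)" for s
    define E where "E s = sint (\<lambda>x. breg p M (\<zeta> s x) (a \<bullet> rot3 (\<beta> + \<omega> * s) x))" for s
    have cd: "continuous_on S2 (\<lambda>x. \<zeta> s x - a \<bullet> rot3 (\<beta> + \<omega> * s) x)" if "0 \<le> s" for s
      by (intro continuous_intros cz cy that)
    have cN: "continuous_on S2 (\<lambda>x. \<bar>\<zeta> s x - a \<bullet> rot3 (\<beta> + \<omega> * s) x\<bar> powr p)" if "0 \<le> s" for s
      using continuous_on_abs_powr[OF cd[OF that]] p by simp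
    have cE: "continuous_on S2 (\<lambda>x. breg p M (\<zeta> s x) (a \<bullet> rot3 (\<beta> + \<omega> * s) x))" if "0 \<le> s" for s
      by (rule continuous_on_breg[OF p cz[OF that] cy])
    have N0: "0 \<le> N s" if "0 \<le> s" for s
      unfolding N_def by (rule sint_nonneg[OF cN[OF that]]) simp
    have L: "Lp_norm p (\<lambda>x. \<zeta> s x - a \<bullet> rot3 (\<beta> + \<omega> * s) x) = N s powr (1 / p)" if "0 \<le> s" for s
      unfolding N_def using p by (intro Lp_norm_eq_sint cd that) auto
    have "N 0 = (N 0 powr (1 / p)) powr p" using N0[of 0] p by (simp add: powr_powr)
    also have "\<dots> < \<delta> powr p"
      using d0 L[of 0] p by (intro powr_less_mono2) auto
    finally have N0\<delta>: "N 0 < \<delta> powr p" .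
    have affine: "sint (\<lambda>x. c * 1 + d * g x) = c * S + d * sint g" if "continuous_on S2 g" for c d g
      unfolding S_def using that by (subst sint_add) (auto intro!: continuous_intros simp: sint_cmult[symmetric])
    have "E 0 \<le> sint (\<lambda>x. (\<eta> / C) * 1 + C' * \<bar>\<zeta> 0 x - a \<bullet> rot3 (\<beta> + \<omega> * 0) x\<bar> powr p)"
      unfolding E_def
      by (rule sint_mono[OF cE]) (use C' y in \<open>auto intro!: continuous_on_add continuous_on_mult continuous_on_const cN[of 0, simplified]\<close>)
    then have E0: "E 0 \<le> \<eta> / C * S + C' * N 0"
      unfolding affine[OF cN[OF order_refl]] N_def[symmetric] .
    have "N t \<le> sint (\<lambda>x. \<eta> * 1 + C * breg p M (\<zeta> t x) (a \<bullet> rot3 (\<beta> + \<omega> * t) x))"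
      unfolding N_def
      by (rule sint_mono[OF cN]) (use C y t in \<open>auto intro!: continuous_on_add continuous_on_mult continuous_on_const cE\<close>)
    then have "N t \<le> \<eta> * S + C * E t"
      using t unfolding affine[OF cE[OF less_imp_le[OF t]]] E_def[symmetric] by simp
    also have "E t = E 0"
      using sint_breg_conserved[OF p sol t, of M a \<beta>] by (simp add: E_def)
    also have "\<eta> * S + C * E 0 \<le> \<eta> * S + C * (\<eta> / C * S + C' * N 0)"
      using E0 C by simp
    also have "\<dots> = 2 * (S * \<eta>) + C * C' * N 0"
      using C by (simp add: field_simps)
    also have "\<dots> < \<epsilon> powr p / 2 + C * C' * \<delta> powr p"
      using S\<eta> N0\<delta> C C' by (intro add_le_less_mono mult_strict_left_mono) auto
    finally have "N t < \<epsilon> powr p" unfolding \<delta> by simp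
    then have "N t powr (1 / p) < (\<epsilon> powr p) powr (1 / p)"
      using N0[of t] t p by (intro powr_less_mono2) auto
    then show "Lp_norm p (\<lambda>x. \<zeta> t x - a \<bullet> rot3 (\<beta> + \<omega> * t) x) < \<epsilon>"
      using L[of t] t \<epsilon> p by (simp add: powr_powr)
  qed
qed

lemma Lp_norm_cong: "(\<And>x. x \<in> S2 \<Longrightarrow> \<bar>f x\<bar> = \<bar>g x\<bar>) \<Longrightarrow> Lp_norm p f = Lp_norm p g"
  unfolding Lp_norm_def
  by (intro arg_cong[of _ _ "\<lambda>I. I powr (1 / p)"] Bochner_Integration.integral_cong)
    (auto simp: area_def space_restrict_space)

lemma rot3_in_S2: "x \<in> S2 \<Longrightarrow> rot3 \<beta> x \<in> S2"
  by (simp add: norm_rot3)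

lemma orbit_eq: "orbit f = {f \<circ> rot3 \<beta> | \<beta>. True}"
  by (auto simp: orbit_def)

text \<open>\<open>LEAST\<close> must be shown to be attained: the distance depends continuously on
  the angle, an angle in [0, 2 pi] minimises it there, and periodicity extends the inequality to all
  angles.\<close>

lemma min_dist_orbit:
  assumes p: "1 < p" and Y: "\<And>x. x \<in> S2 \<Longrightarrow> Y x = a \<bullet> x" and g: "continuous_on S2 g"
  shows min_dist_orbit_attained: "\<exists>\<beta>. min_dist p (orbit Y) g = Lp_norm p (\<lambda>x. g x - a \<bullet> rot3 \<beta> x)"
    and min_dist_orbit_le: "\<And>\<beta>. min_dist p (orbit Y) g \<le> Lp_norm p (\<lambda>x. g x - a \<bullet> rot3 \<beta> x)"
proof -
  define d where "d \<beta> = Lp_norm p (\<lambda>x. g x - a \<bullet> rot3 \<beta> x)" for \<beta>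
  define N where "N \<beta> = sint (\<lambda>x. \<bar>g x - rot3 (- \<beta>) a \<bullet> x\<bar> powr p)" for \<beta>
  have dN: "d \<beta> = N \<beta> powr (1 / p)" for \<beta>
    unfolding d_def N_def inner_rot3 using p by (intro Lp_norm_eq_sint continuous_intros g) auto
  have dY: "Lp_norm p (\<lambda>x. (Y \<circ> rot3 \<beta>) x - g x) = d \<beta>" for \<beta>
    unfolding d_def by (rule Lp_norm_cong) (simp add: Y norm_rot3 abs_minus_commute)
  have "continuous_on UNIV N"
  proof -
    have "continuous_on (UNIV \<times> coord_box) (\<lambda>w. g (sph_coords (snd w)) - rot3 (- fst w) a \<bullet> sph_coords (snd w))"
      by (intro continuous_intros continuous_on_rot3_inner continuous_on_compose2[OF g]
          continuous_on_compose2[OF continuous_on_sph_coords[of UNIV]]) auto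
    then have "continuous_on (UNIV \<times> coord_box) (\<lambda>w. cos (snd (snd w)) * \<bar>g (sph_coords (snd w)) - rot3 (- fst w) a \<bullet> sph_coords (snd w)\<bar> powr p)"
      using p by (intro continuous_on_mult continuous_on_abs_powr) (auto intro!: continuous_intros)
    then show ?thesis
      unfolding N_def sint_def by (intro integral_continuous_on_param) (simp add: case_prod_beta)
  qed
  then have "continuous_on UNIV d"
    unfolding dN[abs_def] using p
    by (intro continuous_on_powr') (auto simp: N_def intro!: sint_nonneg continuous_on_abs_powr continuous_intros g)
  then have cd: "continuous_on {0..2 * pi} d"
    by (rule continuous_on_subset) simp
  have "\<exists>\<alpha>\<in>{0..2 * pi}. \<forall>\<beta>\<in>{0..2 * pi}. d \<alpha> \<le> d \<beta>"
    by (rule continuous_attains_inf[OF compact_Icc _ cd]) simp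
  then obtain \<beta>0 where \<beta>0: "\<And>\<beta>. \<beta> \<in> {0..2 * pi} \<Longrightarrow> d \<beta>0 \<le> d \<beta>"
    by blast
  have le: "d \<beta>0 \<le> d \<beta>" for \<beta>
  proof -
    obtain t where t: "0 \<le> t" "t \<le> 2 * pi" "cos \<beta> = cos t" "sin \<beta> = sin t"
      using sincos_total_2pi_le[of "cos \<beta>" "sin \<beta>"] by auto
    have "rot3 t = rot3 \<beta>" using t by (simp add: fun_eq_iff rot3_def)
    then have "d \<beta> = d t" by (simp add: d_def)
    then show ?thesis using \<beta>0[of t] t by simp
  qed
  have "min_dist p (orbit Y) g = d \<beta>0"
    unfolding min_dist_def
  proof (rule Least_equality)
    show "\<exists>f\<in>orbit Y. d \<beta>0 = Lp_norm p (\<lambda>x. f x - g x)"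
      unfolding orbit_eq dY[symmetric] by blast
    show "d \<beta>0 \<le> y" if "\<exists>f\<in>orbit Y. y = Lp_norm p (\<lambda>x. f x - g x)" for y
      using that le unfolding orbit_eq by (auto simp: dY simp del: comp_apply)
  qed
  then show "\<exists>\<beta>. min_dist p (orbit Y) g = Lp_norm p (\<lambda>x. g x - a \<bullet> rot3 \<beta> x)"
    and "\<And>\<beta>. min_dist p (orbit Y) g \<le> Lp_norm p (\<lambda>x. g x - a \<bullet> rot3 \<beta> x)"
    using le unfolding d_def by auto
qed

theorem theorem5p1:
  fixes p :: real and Y :: "real^3 \<Rightarrow> real"
  assumes "1 < p" and "Y \<in> E1" and "\<exists>x\<in>S2. Y x \<noteq> 0"
  shows "(\<forall>\<epsilon>>0. \<exists>\<delta>>0. \<forall>\<zeta>. smooth_solution 0 \<zeta> \<longrightarrow>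
            Lp_norm p (\<lambda>x. \<zeta> 0 x - Y x) < \<delta> \<longrightarrow>
            (\<forall>t>0. Lp_norm p (\<lambda>x. \<zeta> t x - Y x) < \<epsilon>))
    \<and> (\<forall>\<omega>::real.
         (\<forall>\<epsilon>>0. \<exists>\<delta>>0. \<forall>\<zeta>. smooth_solution \<omega> \<zeta> \<longrightarrow>
            min_dist p (orbit Y) (\<zeta> 0) < \<delta> \<longrightarrow>
            (\<forall>t>0. min_dist p (orbit Y) (\<zeta> t) < \<epsilon>))
       \<and> ((\<exists>\<beta>::real. \<forall>x\<in>S2. Y x = \<beta> * sqrt (3 / (4 * pi)) * x $ 3) \<longrightarrow>
          (\<forall>\<epsilon>>0. \<exists>\<delta>>0. \<forall>\<zeta>. smooth_solution \<omega> \<zeta> \<longrightarrow>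
            Lp_norm p (\<lambda>x. \<zeta> 0 x - Y x) < \<delta> \<longrightarrow>
            (\<forall>t>0. Lp_norm p (\<lambda>x. \<zeta> t x - Y x) < \<epsilon>))))"
proof -
  obtain a where Y: "\<And>x. x \<in> S2 \<Longrightarrow> Y x = a \<bullet> x"
    using E1_linear[OF assms(2)] by blast
  \<comment> \<open>The moving profile is at rest when \<open>Y\<close> is invariant under the
    rotations it undergoes. This covers both \<omega> = 0 and zonal \<open>Y\<close>.\<close>
  have fixed: "\<exists>\<delta>>0. \<forall>\<zeta>. smooth_solution \<omega> \<zeta> \<longrightarrow> Lp_norm p (\<lambda>x. \<zeta> 0 x - Y x) < \<delta> \<longrightarrow>
      (\<forall>t>0. Lp_norm p (\<lambda>x. \<zeta> t x - Y x) < \<epsilon>)"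
    if inv: "\<And>t x. x \<in> S2 \<Longrightarrow> Y (rot3 (\<omega> * t) x) = Y x" and \<epsilon>: "0 < \<epsilon>" for \<omega> \<epsilon>
  proof -
    have eq: "Lp_norm p (\<lambda>x. g x - a \<bullet> rot3 (0 + \<omega> * t) x) = Lp_norm p (\<lambda>x. g x - Y x)" for g t
      by (rule Lp_norm_cong) (simp add: Y[OF rot3_in_S2, symmetric] inv)
    have eq0: "Lp_norm p (\<lambda>x. g x - a \<bullet> rot3 0 x) = Lp_norm p (\<lambda>x. g x - Y x)" for g
      using eq[of g 0] by simp
    obtain \<delta> where \<delta>: "0 < \<delta>" "\<And>\<omega> \<zeta> \<beta> t. \<lbrakk>smooth_solution \<omega> \<zeta>; 0 < t; Lp_norm p (\<lambda>x. \<zeta> 0 x - a \<bullet> rot3 \<beta> x) < \<delta>\<rbrakk>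
        \<Longrightarrow> Lp_norm p (\<lambda>x. \<zeta> t x - a \<bullet> rot3 (\<beta> + \<omega> * t) x) < \<epsilon>"
      using moving_profile_stable[OF assms(1) \<epsilon>, of a] by blast
    have "Lp_norm p (\<lambda>x. \<zeta> t x - Y x) < \<epsilon>"
      if "smooth_solution \<omega> \<zeta>" "Lp_norm p (\<lambda>x. \<zeta> 0 x - Y x) < \<delta>" "0 < t" for \<zeta> t
      using \<delta>(2)[OF that(1,3), of 0] that(2) unfolding eq eq0 by blast
    then show ?thesis using \<delta>(1) by blast
  qed
  have orbit: "\<exists>\<delta>>0. \<forall>\<zeta>. smooth_solution \<omega> \<zeta> \<longrightarrow> min_dist p (orbit Y) (\<zeta> 0) < \<delta> \<longrightarrow>
      (\<forall>t>0. min_dist p (orbit Y) (\<zeta> t) < \<epsilon>)" if \<epsilon>: "0 < \<epsilon>" for \<omega> \<epsilon>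
  proof -
    obtain \<delta> where \<delta>: "0 < \<delta>" "\<And>\<omega> \<zeta> \<beta> t. \<lbrakk>smooth_solution \<omega> \<zeta>; 0 < t; Lp_norm p (\<lambda>x. \<zeta> 0 x - a \<bullet> rot3 \<beta> x) < \<delta>\<rbrakk>
        \<Longrightarrow> Lp_norm p (\<lambda>x. \<zeta> t x - a \<bullet> rot3 (\<beta> + \<omega> * t) x) < \<epsilon>"
      using moving_profile_stable[OF assms(1) \<epsilon>, of a] by blast
    have "min_dist p (orbit Y) (\<zeta> t) < \<epsilon>"
      if sol: "smooth_solution \<omega> \<zeta>" and d: "min_dist p (orbit Y) (\<zeta> 0) < \<delta>" and t: "0 < t" for \<zeta> t
    proof -
      have c: "continuous_on S2 (\<zeta> s)" if "0 \<le> s" for s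
        using sol that by (intro smooth_slice_continuous) (auto simp: smooth_solution_def)
      \<comment> \<open>The solution is compared with the profile that is closest initially; at time
        t this has turned to another member of the orbit, so it bounds the minimum from
        above.\<close>
      obtain \<beta> where "min_dist p (orbit Y) (\<zeta> 0) = Lp_norm p (\<lambda>x. \<zeta> 0 x - a \<bullet> rot3 \<beta> x)"
        using min_dist_orbit_attained[OF assms(1) Y c] by auto
      then have "Lp_norm p (\<lambda>x. \<zeta> t x - a \<bullet> rot3 (\<beta> + \<omega> * t) x) < \<epsilon>"
        using \<delta>(2)[OF sol t] d by simp
      moreover have "min_dist p (orbit Y) (\<zeta> t) \<le> Lp_norm p (\<lambda>x. \<zeta> t x - a \<bullet> rot3 (\<beta> + \<omega> * t) x)"
        using t by (intro min_dist_orbit_le[OF assms(1) Y c]) auto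
      ultimately show ?thesis by linarith
    qed
    then show ?thesis using \<delta>(1) by blast
  qed
  have zonal: "Y (rot3 (\<omega> * t) x) = Y x"
    if "\<forall>x\<in>S2. Y x = \<beta> * sqrt (3 / (4 * pi)) * x $ 3" "x \<in> S2" for \<beta> \<omega> t x
    using that rot3_in_S2[OF that(2), of "\<omega> * t"] by (simp add: rot3_def)
  show ?thesis
  proof (intro conjI allI impI)
    fix \<epsilon> :: real assume "0 < \<epsilon>"
    then show "\<exists>\<delta>>0. \<forall>\<zeta>. smooth_solution 0 \<zeta> \<longrightarrow> Lp_norm p (\<lambda>x. \<zeta> 0 x - Y x) < \<delta> \<longrightarrow>
        (\<forall>t>0. Lp_norm p (\<lambda>x. \<zeta> t x - Y x) < \<epsilon>)"
      by (intro fixed) (simp_all add: rot3_0)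
  next
    fix \<omega> \<epsilon> :: real assume "0 < \<epsilon>"
    then show "\<exists>\<delta>>0. \<forall>\<zeta>. smooth_solution \<omega> \<zeta> \<longrightarrow> min_dist p (orbit Y) (\<zeta> 0) < \<delta> \<longrightarrow>
        (\<forall>t>0. min_dist p (orbit Y) (\<zeta> t) < \<epsilon>)"
      by (rule orbit)
  next
    fix \<omega> \<epsilon> :: real assume "\<exists>\<beta>. \<forall>x\<in>S2. Y x = \<beta> * sqrt (3 / (4 * pi)) * x $ 3" and \<epsilon>: "0 < \<epsilon>"
    then obtain \<beta> where "\<forall>x\<in>S2. Y x = \<beta> * sqrt (3 / (4 * pi)) * x $ 3" by blast
    then show "\<exists>\<delta>>0. \<forall>\<zeta>. smooth_solution \<omega> \<zeta> \<longrightarrow> Lp_norm p (\<lambda>x. \<zeta> 0 x - Y x) < \<delta> \<longrightarrow>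
        (\<forall>t>0. Lp_norm p (\<lambda>x. \<zeta> t x - Y x) < \<epsilon>)"
      using \<epsilon> by (intro fixed) (simp_all only: zonal)
  qed
qed

end
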